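(* Let $A=(A,\mu,\alpha,\beta)$ be a bihom-associative algebra over a field $\mathbb{K}$ of characteristic zero. If $H^3_{\mathrm{Hoch}}(A,A)=0$, then every deformation of $A$ of order $n$ can be extended to a deformation of order $n+1$.
   Context: A bihom-associative algebra $(A,\mu,\alpha,\beta)$ is a vector space (or, over a commutative $\mathbb{K}$-algebra $R$, an $R$-module) $A$ with a bilinear map $\mu:A\times A\to A$ and two commuting linear maps $\alpha,\beta:A\to A$ such that $\alpha(\mu(a,b))=\mu(\alpha(a),\alpha(b))$, $\beta(\mu(a,b))=\mu(\beta(a),\beta(b))$ and $\mu(\alpha(a),\mu(b,c))=\mu(\mu(a,b),\beta(c))$ for all $a,b,c\in A$. For $n\ge1$, $C^n_{\mathrm{Hoch}}(A,A)$ is the space of linear maps $f:A^{\otimes n}\to A$ with $\alpha\circ f=f\circ\alpha^{\otimes n}$ and $\beta\circ f=f\circ\beta^{\otimes n}$, with coboundary $$(\delta_{\mathrm{Hoch}}f)(a_1,\dots,a_{n+1})=\mu(\alpha^{n-1}(a_1),f(a_2,\dots,a_{n+1}))+\sum_{i=1}^n(-1)^if(\alpha(a_1),\dots,\alpha(a_{i-1}),\mu(a_i,a_{i+1}),\beta(a_{i+2}),\dots,\beta(a_{n+1}))+(-1)^{n+1}\mu(f(a_1,\dots,a_n),\beta^{n-1}(a_{n+1})).$$ $H^\bullet_{\mathrm{Hoch}}(A,A)$ is the cohomology of this complex. A deformation of order $n$ of $A$ is a sum $\mu_t=\sum_{i=0}^n\mu_it^i$ with $\mu_i\in C^2_{\mathrm{Hoch}}(A,A)$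 and $\mu_0=\mu$ such that $(A[[t]]/(t^{n+1}),\mu_t,\alpha,\beta)$ is a bihom-associative algebra over $\mathbb{K}[[t]]/(t^{n+1})$ (with $\mu_t,\alpha,\beta$ extended $\mathbb{K}[[t]]/(t^{n+1})$-(bi)linearly). It extends to a deformation of order $n+1$ if there is $\mu_{n+1}\in C^2_{\mathrm{Hoch}}(A,A)$ such that $\mu_t+\mu_{n+1}t^{n+1}$ is a deformation of order $n+1$. *)

theory Defs
  imports "HOL-Algebra.Module" "HOL-Algebra.Elementary_Groups"
begin

section \<open>Bihom-associative algebras\<close>

text \<open>
  Only the module part of the record \<open>A\<close> (carrier, zero, addition, scalar multiplication) is
  used: the locale \<^locale>\<open>module\<close> puts no condition on the fields \<open>mult\<close> and \<open>one\<close>, and the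
  product of the algebra is the separate parameter \<open>\<mu>\<close>.
\<close>

locale bihom_associative_algebra = module R A for R (structure) and A (structure) +
  fixes \<mu> :: "'c \<Rightarrow> 'c \<Rightarrow> 'c" and \<alpha> \<beta> :: "'c \<Rightarrow> 'c"
  assumes mu_closed: "\<lbrakk>a \<in> carrier A; b \<in> carrier A\<rbrakk> \<Longrightarrow> \<mu> a b \<in> carrier A"
    and mu_add_left: "\<lbrakk>a \<in> carrier A; a' \<in> carrier A; b \<in> carrier A\<rbrakk>
      \<Longrightarrow> \<mu> (a \<oplus>\<^bsub>A\<^esub> a') b = \<mu> a b \<oplus>\<^bsub>A\<^esub> \<mu> a' b"
    and mu_add_right: "\<lbrakk>a \<in> carrier A; b \<in> carrier A; b' \<in> carrier A\<rbrakk>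
      \<Longrightarrow> \<mu> a (b \<oplus>\<^bsub>A\<^esub> b') = \<mu> a b \<oplus>\<^bsub>A\<^esub> \<mu> a b'"
    and mu_smult_left: "\<lbrakk>r \<in> carrier R; a \<in> carrier A; b \<in> carrier A\<rbrakk>
      \<Longrightarrow> \<mu> (r \<odot>\<^bsub>A\<^esub> a) b = r \<odot>\<^bsub>A\<^esub> \<mu> a b"
    and mu_smult_right: "\<lbrakk>r \<in> carrier R; a \<in> carrier A; b \<in> carrier A\<rbrakk>
      \<Longrightarrow> \<mu> a (r \<odot>\<^bsub>A\<^esub> b) = r \<odot>\<^bsub>A\<^esub> \<mu> a b"
    and alpha_closed: "a \<in> carrier A \<Longrightarrow> \<alpha> a \<in> carrier A"
    and alpha_add: "\<lbrakk>a \<in> carrier A; b \<in> carrier A\<rbrakk> \<Longrightarrow> \<alpha> (a \<oplus>\<^bsub>A\<^esub> b) = \<alpha> a \<oplus>\<^bsub>A\<^esub> \<alpha> b"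
    and alpha_smult: "\<lbrakk>r \<in> carrier R; a \<in> carrier A\<rbrakk> \<Longrightarrow> \<alpha> (r \<odot>\<^bsub>A\<^esub> a) = r \<odot>\<^bsub>A\<^esub> \<alpha> a"
    and beta_closed: "a \<in> carrier A \<Longrightarrow> \<beta> a \<in> carrier A"
    and beta_add: "\<lbrakk>a \<in> carrier A; b \<in> carrier A\<rbrakk> \<Longrightarrow> \<beta> (a \<oplus>\<^bsub>A\<^esub> b) = \<beta> a \<oplus>\<^bsub>A\<^esub> \<beta> b"
    and beta_smult: "\<lbrakk>r \<in> carrier R; a \<in> carrier A\<rbrakk> \<Longrightarrow> \<beta> (r \<odot>\<^bsub>A\<^esub> a) = r \<odot>\<^bsub>A\<^esub> \<beta> a"
    and alpha_beta_commute: "a \<in> carrier A \<Longrightarrow> \<alpha> (\<beta> a) = \<beta> (\<alpha> a)"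
    and alpha_mu: "\<lbrakk>a \<in> carrier A; b \<in> carrier A\<rbrakk> \<Longrightarrow> \<alpha> (\<mu> a b) = \<mu> (\<alpha> a) (\<alpha> b)"
    and beta_mu: "\<lbrakk>a \<in> carrier A; b \<in> carrier A\<rbrakk> \<Longrightarrow> \<beta> (\<mu> a b) = \<mu> (\<beta> a) (\<beta> b)"
    and bihom_assoc: "\<lbrakk>a \<in> carrier A; b \<in> carrier A; c \<in> carrier A\<rbrakk>
      \<Longrightarrow> \<mu> (\<alpha> a) (\<mu> b c) = \<mu> (\<mu> a b) (\<beta> c)"


section \<open>The Hochschild complex\<close>

text \<open>
  A linear map on the \<open>n\<close>-th tensor power of \<open>A\<close> is represented by the corresponding multilinear
  map on \<open>n\<close>-tuples.  A tuple \<open>(a\<^sub>1, \<dots>, a\<^sub>n)\<close> is a list \<open>xs\<close> of length \<open>n\<close> with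
  \<open>a\<^sub>i = xs ! (i - 1)\<close>.  Multilinear maps are extensional (\<open>undefined\<close> outside the \<open>n\<close>-tuples), so
  that equality of maps is HOL equality.
\<close>

definition tuples :: "('a, 'b) partial_object_scheme \<Rightarrow> nat \<Rightarrow> 'a list set" where
  "tuples A n = {xs. length xs = n \<and> set xs \<subseteq> carrier A}"

definition multilinear_maps ::
  "('k, 'm) ring_scheme \<Rightarrow> ('k, 'a, 'n) module_scheme \<Rightarrow> nat \<Rightarrow> ('a list \<Rightarrow> 'a) set" where
  "multilinear_maps R A n =
    {f \<in> tuples A n \<rightarrow>\<^sub>E carrier A.
      \<forall>xs \<in> tuples A n. \<forall>i < n.
        (\<forall>x \<in> carrier A. \<forall>y \<in> carrier A.
          f (xs[i := x \<oplus>\<^bsub>A\<^esub> y]) = f (xs[i := x]) \<oplus>\<^bsub>A\<^esub> f (xs[i := y])) \<and>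
        (\<forall>r \<in> carrier R. \<forall>x \<in> carrier A.
          f (xs[i := r \<odot>\<^bsub>A\<^esub> x]) = r \<odot>\<^bsub>A\<^esub> f (xs[i := x]))}"

definition hoch_cochains ::
  "('k, 'm) ring_scheme \<Rightarrow> ('k, 'a, 'n) module_scheme \<Rightarrow> ('a \<Rightarrow> 'a) \<Rightarrow> ('a \<Rightarrow> 'a) \<Rightarrow> nat
    \<Rightarrow> ('a list \<Rightarrow> 'a) set" where
  "hoch_cochains R A \<alpha> \<beta> n =
    {f \<in> multilinear_maps R A n.
      \<forall>xs \<in> tuples A n. \<alpha> (f xs) = f (map \<alpha> xs) \<and> \<beta> (f xs) = f (map \<beta> xs)}"

definition hoch_cochain_group ::
  "('k, 'm) ring_scheme \<Rightarrow> ('k, 'a, 'n) module_scheme \<Rightarrow> ('a \<Rightarrow> 'a) \<Rightarrow> ('a \<Rightarrow> 'a) \<Rightarrow> nat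
    \<Rightarrow> ('a list \<Rightarrow> 'a) monoid" where
  "hoch_cochain_group R A \<alpha> \<beta> n =
    \<lparr>carrier = hoch_cochains R A \<alpha> \<beta> n,
     monoid.mult = (\<lambda>f g. \<lambda>xs \<in> tuples A n. f xs \<oplus>\<^bsub>A\<^esub> g xs),
     one = (\<lambda>xs \<in> tuples A n. \<zero>\<^bsub>A\<^esub>)\<rparr>"

text \<open>
  The coboundary on \<open>n\<close>-cochains, for \<open>n \<ge> 1\<close>.  With \<open>xs = [a\<^sub>1, \<dots>, a\<^sub>n\<^sub>+\<^sub>1]\<close>, \<open>take (i - 1) xs\<close> is
  \<open>[a\<^sub>1, \<dots>, a\<^sub>i\<^sub>-\<^sub>1]\<close> and \<open>drop (i + 1) xs\<close> is \<open>[a\<^sub>i\<^sub>+\<^sub>2, \<dots>, a\<^sub>n\<^sub>+\<^sub>1]\<close>.  A sign \<open>(-1)\<^sup>i\<close> acts as the scalar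
  \<open>(\<ominus>\<^bsub>R\<^esub> \<one>\<^bsub>R\<^esub>) [^]\<^bsub>R\<^esub> i\<close>.
\<close>

definition hoch_coboundary ::
  "('k, 'm) ring_scheme \<Rightarrow> ('k, 'a, 'n) module_scheme \<Rightarrow> ('a \<Rightarrow> 'a \<Rightarrow> 'a) \<Rightarrow> ('a \<Rightarrow> 'a) \<Rightarrow> ('a \<Rightarrow> 'a)
    \<Rightarrow> nat \<Rightarrow> ('a list \<Rightarrow> 'a) \<Rightarrow> ('a list \<Rightarrow> 'a)" where
  "hoch_coboundary R A \<mu> \<alpha> \<beta> n f =
    (\<lambda>xs \<in> tuples A (n + 1).
      \<mu> ((\<alpha> ^^ (n - 1)) (hd xs)) (f (tl xs))
      \<oplus>\<^bsub>A\<^esub> (\<Oplus>\<^bsub>A\<^esub>i \<in> {1..n}. ((\<ominus>\<^bsub>R\<^esub> \<one>\<^bsub>R\<^esub>) [^]\<^bsub>R\<^esub> i) \<odot>\<^bsub>A\<^esub>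
             f (map \<alpha> (take (i - 1) xs) @ [\<mu> (xs ! (i - 1)) (xs ! i)] @ map \<beta> (drop (i + 1) xs)))
      \<oplus>\<^bsub>A\<^esub> ((\<ominus>\<^bsub>R\<^esub> \<one>\<^bsub>R\<^esub>) [^]\<^bsub>R\<^esub> (n + 1)) \<odot>\<^bsub>A\<^esub>
             \<mu> (f (butlast xs)) ((\<beta> ^^ (n - 1)) (last xs)))"

definition hoch_cocycles ::
  "('k, 'm) ring_scheme \<Rightarrow> ('k, 'a, 'n) module_scheme \<Rightarrow> ('a \<Rightarrow> 'a \<Rightarrow> 'a) \<Rightarrow> ('a \<Rightarrow> 'a) \<Rightarrow> ('a \<Rightarrow> 'a)
    \<Rightarrow> nat \<Rightarrow> ('a list \<Rightarrow> 'a) set" where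
  "hoch_cocycles R A \<mu> \<alpha> \<beta> n =
    kernel (hoch_cochain_group R A \<alpha> \<beta> n) (hoch_cochain_group R A \<alpha> \<beta> (n + 1))
      (hoch_coboundary R A \<mu> \<alpha> \<beta> n)"

text \<open>The complex starts in degree \<open>1\<close>, so the only coboundary of degree at most \<open>1\<close> is zero.\<close>

definition hoch_coboundaries ::
  "('k, 'm) ring_scheme \<Rightarrow> ('k, 'a, 'n) module_scheme \<Rightarrow> ('a \<Rightarrow> 'a \<Rightarrow> 'a) \<Rightarrow> ('a \<Rightarrow> 'a) \<Rightarrow> ('a \<Rightarrow> 'a)
    \<Rightarrow> nat \<Rightarrow> ('a list \<Rightarrow> 'a) set" where
  "hoch_coboundaries R A \<mu> \<alpha> \<beta> n =
    (if n \<le> 1 then {\<one>\<^bsub>hoch_cochain_group R A \<alpha> \<beta> n\<^esub>}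
     else hoch_coboundary R A \<mu> \<alpha> \<beta> (n - 1) ` hoch_cochains R A \<alpha> \<beta> (n - 1))"

text \<open>
  The cohomology in degree \<open>n \<ge> 1\<close>, as the (additively meant) group underlying the quotient vector
  space of cocycles modulo coboundaries.
\<close>

definition hoch_cohomology ::
  "('k, 'm) ring_scheme \<Rightarrow> ('k, 'a, 'n) module_scheme \<Rightarrow> ('a \<Rightarrow> 'a \<Rightarrow> 'a) \<Rightarrow> ('a \<Rightarrow> 'a) \<Rightarrow> ('a \<Rightarrow> 'a)
    \<Rightarrow> nat \<Rightarrow> ('a list \<Rightarrow> 'a) set monoid" where
  "hoch_cohomology R A \<mu> \<alpha> \<beta> n =
    (hoch_cochain_group R A \<alpha> \<beta> n)\<lparr>carrier := hoch_cocycles R A \<mu> \<alpha> \<beta> n\<rparr>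
      Mod hoch_coboundaries R A \<mu> \<alpha> \<beta> n"


section \<open>Truncated power series and deformations of finite order\<close>

text \<open>
  The class of a power series modulo \<open>t\<^sup>n\<^sup>+\<^sup>1\<close> is represented by its coefficients of
  \<open>t\<^sup>0, \<dots>, t\<^sup>n\<close>, that is, by an extensional function on \<open>{..n}\<close>.  Thus \<open>trunc_ring R n\<close> is
  \<open>R[[t]]/(t\<^sup>n\<^sup>+\<^sup>1)\<close> and \<open>trunc_module A n\<close> is the \<open>R[[t]]/(t\<^sup>n\<^sup>+\<^sup>1)\<close>-module \<open>A[[t]]/(t\<^sup>n\<^sup>+\<^sup>1)\<close>.  The
  record fields \<open>mult\<close> and \<open>one\<close> of the latter are irrelevant.
\<close>

definition trunc_ring :: "('k, 'm) ring_scheme \<Rightarrow> nat \<Rightarrow> (nat \<Rightarrow> 'k) ring" where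
  "trunc_ring R n =
    \<lparr>carrier = {..n} \<rightarrow>\<^sub>E carrier R,
     monoid.mult = (\<lambda>f g. \<lambda>k \<in> {..n}. \<Oplus>\<^bsub>R\<^esub>i \<in> {..k}. f i \<otimes>\<^bsub>R\<^esub> g (k - i)),
     one = (\<lambda>k \<in> {..n}. if k = 0 then \<one>\<^bsub>R\<^esub> else \<zero>\<^bsub>R\<^esub>),
     zero = (\<lambda>k \<in> {..n}. \<zero>\<^bsub>R\<^esub>),
     add = (\<lambda>f g. \<lambda>k \<in> {..n}. f k \<oplus>\<^bsub>R\<^esub> g k)\<rparr>"

definition trunc_module ::
  "('k, 'a, 'n) module_scheme \<Rightarrow> nat \<Rightarrow> (nat \<Rightarrow> 'k, nat \<Rightarrow> 'a) module" where
  "trunc_module A n =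
    \<lparr>carrier = {..n} \<rightarrow>\<^sub>E carrier A,
     monoid.mult = undefined,
     one = undefined,
     zero = (\<lambda>k \<in> {..n}. \<zero>\<^bsub>A\<^esub>),
     add = (\<lambda>x y. \<lambda>k \<in> {..n}. x k \<oplus>\<^bsub>A\<^esub> y k),
     smult = (\<lambda>r x. \<lambda>k \<in> {..n}. \<Oplus>\<^bsub>A\<^esub>i \<in> {..k}. r i \<odot>\<^bsub>A\<^esub> x (k - i))\<rparr>"

definition trunc_linear_ext :: "nat \<Rightarrow> ('a \<Rightarrow> 'a) \<Rightarrow> (nat \<Rightarrow> 'a) \<Rightarrow> (nat \<Rightarrow> 'a)" where
  "trunc_linear_ext n \<phi> x = (\<lambda>k \<in> {..n}. \<phi> (x k))"

text \<open>
  The \<open>R[[t]]/(t\<^sup>n\<^sup>+\<^sup>1)\<close>-bilinear extension of \<open>\<mu>\<^sub>t = \<Sum>\<^sub>i \<mu>\<^sub>i t\<^sup>i\<close>: the coefficient of \<open>t\<^sup>k\<close> in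
  \<open>\<mu>\<^sub>t(\<Sum>\<^sub>j x\<^sub>j t\<^sup>j, \<Sum>\<^sub>l y\<^sub>l t\<^sup>l)\<close> is the sum of all \<open>\<mu>\<^sub>i(x\<^sub>j, y\<^sub>l)\<close> with \<open>i + j + l = k\<close>.
\<close>

definition trunc_bilinear_ext ::
  "('k, 'a, 'n) module_scheme \<Rightarrow> nat \<Rightarrow> (nat \<Rightarrow> 'a list \<Rightarrow> 'a)
    \<Rightarrow> (nat \<Rightarrow> 'a) \<Rightarrow> (nat \<Rightarrow> 'a) \<Rightarrow> (nat \<Rightarrow> 'a)" where
  "trunc_bilinear_ext A n \<mu>s x y =
    (\<lambda>k \<in> {..n}. \<Oplus>\<^bsub>A\<^esub>i \<in> {..k}. \<Oplus>\<^bsub>A\<^esub>j \<in> {..k - i}. \<mu>s i [x j, y (k - i - j)])"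

text \<open>\<open>\<mu>s i\<close> is the coefficient \<open>\<mu>\<^sub>i\<close> of \<open>\<mu>\<^sub>t\<close>; only the values of \<open>\<mu>s\<close> at \<open>0, \<dots>, n\<close> matter.\<close>

definition is_deformation ::
  "('k, 'm) ring_scheme \<Rightarrow> ('k, 'a, 'n) module_scheme \<Rightarrow> ('a \<Rightarrow> 'a \<Rightarrow> 'a) \<Rightarrow> ('a \<Rightarrow> 'a) \<Rightarrow> ('a \<Rightarrow> 'a)
    \<Rightarrow> nat \<Rightarrow> (nat \<Rightarrow> 'a list \<Rightarrow> 'a) \<Rightarrow> bool" where
  "is_deformation R A \<mu> \<alpha> \<beta> n \<mu>s \<longleftrightarrow>
    (\<forall>i \<le> n. \<mu>s i \<in> hoch_cochains R A \<alpha> \<beta> 2) \<and>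
    (\<forall>a \<in> carrier A. \<forall>b \<in> carrier A. \<mu>s 0 [a, b] = \<mu> a b) \<and>
    bihom_associative_algebra (trunc_ring R n) (trunc_module A n)
      (trunc_bilinear_ext A n \<mu>s) (trunc_linear_ext n \<alpha>) (trunc_linear_ext n \<beta>)"

end

theory Submission
  imports Defs
begin

text \<open>
  The argument is Gerstenhaber's obstruction theory.  For a family \<open>\<mu>\<^sub>0 = \<mu>, \<mu>\<^sub>1, \<dots>\<close> of multiplicative
  bilinear maps, let \<open>E\<^sub>s(a, b, c) = \<Sum>\<^sub>i\<^sub>+\<^sub>j\<^sub>=\<^sub>s \<mu>\<^sub>i(\<mu>\<^sub>j(a, b), \<beta> c) - \<mu>\<^sub>i(\<alpha> a, \<mu>\<^sub>j(b, c))\<close> be the coefficient of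
  \<open>t\<^sup>s\<close> in the associator of \<open>\<mu>\<^sub>t\<close>.  The truncated power series with the product \<open>\<mu>\<^sub>t\<close> satisfy all other
  axioms of a bihom-associative algebra automatically, and they are bihom-associative exactly when
  \<open>E\<^sub>s = 0\<close> for all \<open>s\<close> up to the order of truncation (\<open>trunc_bihom_associative_iff\<close>).

  Suppose that this holds up to order \<open>n\<close>, and continue the family by \<open>\<mu>\<^sub>n\<^sub>+\<^sub>1 = 0\<close>.  Every
  multiplicative bilinear product obeys a pentagon identity for its associator, and its coefficient of \<open>t\<^sup>n\<^sup>+\<^sup>1\<close> says that
  \<open>E\<^sub>n\<^sub>+\<^sub>1\<close> is a Hochschild cocycle of degree \<open>3\<close> (\<open>bihom_pentagon\<close>, \<open>associator_cocycle\<close>).  As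
  \<open>H\<^sup>3 = 0\<close>, there is a 2-cochain \<open>f\<close> with \<open>\<delta> f = E\<^sub>n\<^sub>+\<^sub>1\<close>.  Taking \<open>\<mu>\<^sub>n\<^sub>+\<^sub>1 = f\<close> instead leaves \<open>E\<^sub>s\<close>
  unchanged for \<open>s \<le> n\<close> and subtracts \<open>\<delta> f\<close> from \<open>E\<^sub>n\<^sub>+\<^sub>1\<close> (\<open>coeff_update_top\<close>), which therefore becomes
  zero.
\<close>


section \<open>Rearranging nested finite sums\<close>

lemma (in abelian_monoid) finsum_Sigma:
  assumes "finite A" "\<And>a. a \<in> A \<Longrightarrow> finite (B a)"
    and "\<And>a b. \<lbrakk>a \<in> A; b \<in> B a\<rbrakk> \<Longrightarrow> f a b \<in> carrier G"
  shows "(\<Oplus>a\<in>A. \<Oplus>b\<in>B a. f a b) = finsum G (case_prod f) (Sigma A B)"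
  using assms
proof (induction A rule: finite_induct)
  case empty
  then show ?case by simp
next
  case (insert x F)
  have *: "finsum G (case_prod f) (Pair x ` B x) = (\<Oplus>b\<in>B x. f x b)"
    using insert.prems by (subst finsum_reindex) (auto simp: inj_on_def)
  have "Sigma (insert x F) B = Pair x ` B x \<union> Sigma F B"
    by auto
  then have "finsum G (case_prod f) (Sigma (insert x F) B)
    = finsum G (case_prod f) (Pair x ` B x) \<oplus> finsum G (case_prod f) (Sigma F B)"
    using insert.hyps insert.prems by (simp only:, subst finsum_Un_disjoint) auto
  also have "\<dots> = (\<Oplus>b\<in>B x. f x b) \<oplus> (\<Oplus>a\<in>F. \<Oplus>b\<in>B a. f a b)"
    using insert by (simp add: *)
  also have "\<dots> = (\<Oplus>a\<in>insert x F. \<Oplus>b\<in>B a. f a b)"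
    using insert.hyps insert.prems by (subst finsum_insert) (auto intro!: finsum_closed)
  finally show ?case by simp
qed

lemma (in abelian_monoid) finsum_reindex_bij_witness:
  assumes "\<And>x. x \<in> S \<Longrightarrow> h x \<in> T" "\<And>y. y \<in> T \<Longrightarrow> h' y \<in> S"
    and "\<And>x. x \<in> S \<Longrightarrow> h' (h x) = x" "\<And>y. y \<in> T \<Longrightarrow> h (h' y) = y"
    and "\<And>y. y \<in> T \<Longrightarrow> g y \<in> carrier G" "\<And>x. x \<in> S \<Longrightarrow> f x = g (h x)"
  shows "finsum G f S = finsum G g T"
proof -
  have bij: "bij_betw h S T"
    by (rule bij_betw_byWitness[where f' = h']) (use assms in auto)
  have "finsum G f S = (\<Oplus>x\<in>S. g (h x))"
    by (rule finsum_cong') (use assms in auto)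
  also have "\<dots> = finsum G g (h ` S)"
    by (rule finsum_reindex[symmetric]) (use assms bij in \<open>auto simp: bij_betw_def\<close>)
  finally show ?thesis
    using bij by (simp add: bij_betw_def)
qed

text \<open>
  Every exchange of summation below has this form: the index sets on both sides are graphs of
  dependent pairs, and \<open>h\<close>, \<open>h'\<close> are mutually inverse reparametrisations.
\<close>

lemma (in abelian_monoid) finsum_nested_reindex:
  assumes fin: "finite A" "\<And>a. a \<in> A \<Longrightarrow> finite (B a)" "finite C" "\<And>c. c \<in> C \<Longrightarrow> finite (D c)"
    and h: "\<And>a b. \<lbrakk>a \<in> A; b \<in> B a\<rbrakk> \<Longrightarrow> h (a, b) \<in> Sigma C D \<and> h' (h (a, b)) = (a, b)"
    and h': "\<And>c d. \<lbrakk>c \<in> C; d \<in> D c\<rbrakk> \<Longrightarrow> h' (c, d) \<in> Sigma A B \<and> h (h' (c, d)) = (c, d)"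
    and g: "\<And>c d. \<lbrakk>c \<in> C; d \<in> D c\<rbrakk> \<Longrightarrow> g c d \<in> carrier G"
    and fg: "\<And>a b. \<lbrakk>a \<in> A; b \<in> B a\<rbrakk> \<Longrightarrow> f a b = (case h (a, b) of (c, d) \<Rightarrow> g c d)"
  shows "(\<Oplus>a\<in>A. \<Oplus>b\<in>B a. f a b) = (\<Oplus>c\<in>C. \<Oplus>d\<in>D c. g c d)"
proof -
  have f: "f a b \<in> carrier G" if "a \<in> A" "b \<in> B a" for a b
    using h[OF that] g by (auto simp: fg[OF that] split: prod.split)
  have "(\<Oplus>a\<in>A. \<Oplus>b\<in>B a. f a b) = finsum G (case_prod f) (Sigma A B)"
    by (rule finsum_Sigma) (use fin f in auto)
  also have "\<dots> = finsum G (case_prod g) (Sigma C D)"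
    by (rule finsum_reindex_bij_witness[where h = h and h' = h'])
      (use h h' g fg in \<open>auto 0 3\<close>)
  also have "\<dots> = (\<Oplus>c\<in>C. \<Oplus>d\<in>D c. g c d)"
    by (rule finsum_Sigma[symmetric]) (use fin g in auto)
  finally show ?thesis .
qed

lemma (in abelian_monoid) finsum_antidiagonal_commute:
  fixes k :: nat
  assumes "\<And>i j. i + j = k \<Longrightarrow> f i j \<in> carrier G"
  shows "(\<Oplus>i\<in>{..k}. f i (k - i)) = (\<Oplus>i\<in>{..k}. f (k - i) i)"
  by (rule finsum_reindex_bij_witness[where h = "\<lambda>i. k - i" and h' = "\<lambda>i. k - i"])
    (use assms in auto)

lemma (in abelian_monoid) finsum_antidiagonal_assoc:
  fixes k :: nat
  assumes "\<And>i j l. i + j + l = k \<Longrightarrow> f i j l \<in> carrier G"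
  shows "(\<Oplus>i\<in>{..k}. \<Oplus>j\<in>{..i}. f j (i - j) (k - i))
    = (\<Oplus>i\<in>{..k}. \<Oplus>j\<in>{..k - i}. f i j (k - i - j))"
  by (rule finsum_nested_reindex[where h = "\<lambda>(i, j). (j, i - j)" and h' = "\<lambda>(i, j). (i + j, i)"])
    (use assms in auto)

lemma (in abelian_monoid) finsum_triples_rotate:
  fixes k :: nat
  assumes "\<And>i j l. i + j + l = k \<Longrightarrow> f i j l \<in> carrier G"
  shows "(\<Oplus>i\<in>{..k}. \<Oplus>j\<in>{..k - i}. f j (k - i - j) i)
    = (\<Oplus>i\<in>{..k}. \<Oplus>j\<in>{..k - i}. f i j (k - i - j))"
  by (rule finsum_nested_reindex[where h = "\<lambda>(i, j). (j, k - i - j)"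
        and h' = "\<lambda>(i, j). (k - i - j, i)"])
    (use assms in auto)

lemma (in abelian_monoid) finsum_triples_transpose:
  fixes k :: nat
  assumes "\<And>i j l. i + j + l = k \<Longrightarrow> f i j l \<in> carrier G"
  shows "(\<Oplus>i\<in>{..k}. \<Oplus>j\<in>{..k - i}. f j i (k - i - j))
    = (\<Oplus>i\<in>{..k}. \<Oplus>j\<in>{..k - i}. f i j (k - i - j))"
  by (rule finsum_nested_reindex[where h = "\<lambda>(i, j). (j, i)" and h' = "\<lambda>(i, j). (j, i)"])
    (use assms in \<open>auto simp: add.commute\<close>)

lemma (in abelian_monoid) finsum_only:
  assumes "finite S" "m \<in> S" "f m \<in> carrier G" "\<And>i. \<lbrakk>i \<in> S; i \<noteq> m\<rbrakk> \<Longrightarrow> f i = \<zero>"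
  shows "finsum G f S = f m"
proof -
  have "finsum G f S = (\<Oplus>i\<in>S. if i = m then f m else \<zero>)"
    by (rule finsum_cong') (use assms in auto)
  also have "\<dots> = f m"
    by (rule add.finprod_singleton_swap) (use assms in auto)
  finally show ?thesis .
qed

lemma (in abelian_group) finsum_minus:
  assumes "\<And>i. i \<in> S \<Longrightarrow> f i \<in> carrier G" "\<And>i. i \<in> S \<Longrightarrow> g i \<in> carrier G"
  shows "(\<Oplus>i\<in>S. f i \<ominus> g i) = finsum G f S \<ominus> finsum G g S"
proof -
  have eq: "f i = (f i \<ominus> g i) \<oplus> g i" if "i \<in> S" for i
    using assms[OF that] by (simp add: a_minus_def a_assoc l_neg)
  have "finsum G f S = (\<Oplus>i\<in>S. (f i \<ominus> g i) \<oplus> g i)"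
    by (rule finsum_cong') (use assms eq in auto)
  also have "\<dots> = (\<Oplus>i\<in>S. f i \<ominus> g i) \<oplus> finsum G g S"
    by (rule finsum_addf) (use assms in auto)
  finally have "finsum G f S = (\<Oplus>i\<in>S. f i \<ominus> g i) \<oplus> finsum G g S" .
  moreover have "x \<oplus> y \<ominus> y = x" if "x \<in> carrier G" "y \<in> carrier G" for x y
    using that by (simp add: a_minus_def a_assoc r_neg)
  ultimately show ?thesis
    using assms by (simp add: finsum_closed Pi_iff)
qed

text \<open>
  This isolates the top coefficient of an associator in a sum in which the lower ones vanish.
\<close>

lemma (in abelian_group) finsum_minus_only_0:
  fixes n :: nat
  assumes "\<And>i. i \<le> n \<Longrightarrow> f i \<in> carrier G" "\<And>i. i \<le> n \<Longrightarrow> g i \<in> carrier G"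
    and "\<And>i. \<lbrakk>0 < i; i \<le> n\<rbrakk> \<Longrightarrow> f i = g i"
  shows "finsum G f {..n} \<ominus> finsum G g {..n} = f 0 \<ominus> g 0"
proof -
  have "finsum G f {..n} \<ominus> finsum G g {..n} = (\<Oplus>i\<in>{..n}. f i \<ominus> g i)"
    by (rule finsum_minus[symmetric]) (use assms in auto)
  also have "\<dots> = f 0 \<ominus> g 0"
    by (rule finsum_only) (use assms in \<open>auto simp: a_minus_def r_neg\<close>)
  finally show ?thesis .
qed

lemma additive_zero:
  assumes "abelian_group G" "abelian_group H"
    and closed: "\<And>x. x \<in> carrier G \<Longrightarrow> \<phi> x \<in> carrier H"
    and add: "\<And>x y. \<lbrakk>x \<in> carrier G; y \<in> carrier G\<rbrakk> \<Longrightarrow> \<phi> (x \<oplus>\<^bsub>G\<^esub> y) = \<phi> x \<oplus>\<^bsub>H\<^esub> \<phi> y"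
  shows "\<phi> \<zero>\<^bsub>G\<^esub> = \<zero>\<^bsub>H\<^esub>"
proof -
  interpret G: abelian_group G by fact
  interpret H: abelian_group H by fact
  have "\<phi> \<zero>\<^bsub>G\<^esub> \<oplus>\<^bsub>H\<^esub> \<phi> \<zero>\<^bsub>G\<^esub> = \<phi> \<zero>\<^bsub>G\<^esub>"
    using add[of "\<zero>\<^bsub>G\<^esub>" "\<zero>\<^bsub>G\<^esub>"] by simp
  then show ?thesis
    using closed[of "\<zero>\<^bsub>G\<^esub>"] by (simp add: H.add.l_cancel_one)
qed

lemma additive_minus:
  assumes "abelian_group G" "abelian_group H"
    and closed: "\<And>x. x \<in> carrier G \<Longrightarrow> \<phi> x \<in> carrier H"
    and add: "\<And>x y. \<lbrakk>x \<in> carrier G; y \<in> carrier G\<rbrakk> \<Longrightarrow> \<phi> (x \<oplus>\<^bsub>G\<^esub> y) = \<phi> x \<oplus>\<^bsub>H\<^esub> \<phi> y"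
    and xy: "x \<in> carrier G" "y \<in> carrier G"
  shows "\<phi> (x \<ominus>\<^bsub>G\<^esub> y) = \<phi> x \<ominus>\<^bsub>H\<^esub> \<phi> y"
proof -
  interpret G: abelian_group G by fact
  interpret H: abelian_group H by fact
  have "\<phi> x = \<phi> (x \<ominus>\<^bsub>G\<^esub> y) \<oplus>\<^bsub>H\<^esub> \<phi> y"
    using add[of "x \<ominus>\<^bsub>G\<^esub> y" y] xy by (simp add: a_minus_def G.a_assoc G.l_neg)
  then show ?thesis
    using xy closed by (simp add: a_minus_def H.a_assoc H.r_neg)
qed

lemma additive_finsum:
  assumes GH: "abelian_group G" "abelian_group H"
    and closed: "\<And>x. x \<in> carrier G \<Longrightarrow> \<phi> x \<in> carrier H"
    and add: "\<And>x y. \<lbrakk>x \<in> carrier G; y \<in> carrier G\<rbrakk> \<Longrightarrow> \<phi> (x \<oplus>\<^bsub>G\<^esub> y) = \<phi> x \<oplus>\<^bsub>H\<^esub> \<phi> y"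
    and f: "\<And>i. i \<in> S \<Longrightarrow> f i \<in> carrier G"
  shows "\<phi> (finsum G f S) = (\<Oplus>\<^bsub>H\<^esub>i\<in>S. \<phi> (f i))"
proof -
  interpret G: abelian_group G by fact
  interpret H: abelian_group H by fact
  have 0: "\<phi> \<zero>\<^bsub>G\<^esub> = \<zero>\<^bsub>H\<^esub>"
    by (rule additive_zero[OF GH]) (use closed add in auto)
  show ?thesis
    using f
  proof (induction S rule: infinite_finite_induct)
    case (insert x F)
    have "finsum G f (insert x F) = f x \<oplus>\<^bsub>G\<^esub> finsum G f F"
      by (rule G.finsum_insert) (use insert in auto)
    moreover have "(\<Oplus>\<^bsub>H\<^esub>i\<in>insert x F. \<phi> (f i)) = \<phi> (f x) \<oplus>\<^bsub>H\<^esub> (\<Oplus>\<^bsub>H\<^esub>i\<in>F. \<phi> (f i))"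
      by (rule H.finsum_insert) (use insert closed in auto)
    ultimately show ?case
      using insert by (simp add: add G.finsum_closed Pi_iff)
  qed (simp_all add: 0)
qed

section \<open>The module of truncated power series\<close>

lemma trunc_module_simps:
  "carrier (trunc_module A n) = {..n} \<rightarrow>\<^sub>E carrier A"
  "\<zero>\<^bsub>trunc_module A n\<^esub> = (\<lambda>k\<in>{..n}. \<zero>\<^bsub>A\<^esub>)"
  "x \<oplus>\<^bsub>trunc_module A n\<^esub> y = (\<lambda>k\<in>{..n}. x k \<oplus>\<^bsub>A\<^esub> y k)"
  "r \<odot>\<^bsub>trunc_module A n\<^esub> x = (\<lambda>k\<in>{..n}. \<Oplus>\<^bsub>A\<^esub>i\<in>{..k}. r i \<odot>\<^bsub>A\<^esub> x (k - i))"
  by (simp_all add: trunc_module_def)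

lemma trunc_ring_simps:
  "carrier (trunc_ring R n) = {..n} \<rightarrow>\<^sub>E carrier R"
  "\<zero>\<^bsub>trunc_ring R n\<^esub> = (\<lambda>k\<in>{..n}. \<zero>\<^bsub>R\<^esub>)"
  "\<one>\<^bsub>trunc_ring R n\<^esub> = (\<lambda>k\<in>{..n}. if k = 0 then \<one>\<^bsub>R\<^esub> else \<zero>\<^bsub>R\<^esub>)"
  "f \<oplus>\<^bsub>trunc_ring R n\<^esub> g = (\<lambda>k\<in>{..n}. f k \<oplus>\<^bsub>R\<^esub> g k)"
  "f \<otimes>\<^bsub>trunc_ring R n\<^esub> g = (\<lambda>k\<in>{..n}. \<Oplus>\<^bsub>R\<^esub>i\<in>{..k}. f i \<otimes>\<^bsub>R\<^esub> g (k - i))"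
  by (simp_all add: trunc_ring_def)

lemma PiE_atMost_eqI:
  assumes "x \<in> {..n::nat} \<rightarrow>\<^sub>E X" "y \<in> {..n} \<rightarrow>\<^sub>E X" "\<And>k. k \<le> n \<Longrightarrow> x k = y k"
  shows "x = y"
  by (rule PiE_ext) (use assms in auto)

lemma PiE_atMost_mem: "\<lbrakk>x \<in> {..n::nat} \<rightarrow>\<^sub>E X; k \<le> n\<rbrakk> \<Longrightarrow> x k \<in> X"
  by auto

text \<open>
  The additive parts of the truncated ring and of the truncated module are the same construction,
  so both are covered by stating the operations as hypotheses.
\<close>

lemma pointwise_abelian_group:
  assumes "abelian_group A"
    and G: "carrier G = {..n::nat} \<rightarrow>\<^sub>E carrier A" "\<zero>\<^bsub>G\<^esub> = (\<lambda>k\<in>{..n}. \<zero>\<^bsub>A\<^esub>)"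
      "\<And>x y. x \<oplus>\<^bsub>G\<^esub> y = (\<lambda>k\<in>{..n}. x k \<oplus>\<^bsub>A\<^esub> y k)"
  shows "abelian_group G"
proof -
  interpret A: abelian_group A by fact
  show ?thesis
  proof (rule abelian_groupI; unfold G)
    fix x assume x: "x \<in> {..n} \<rightarrow>\<^sub>E carrier A"
    show "\<exists>y\<in>{..n} \<rightarrow>\<^sub>E carrier A. (\<lambda>k\<in>{..n}. y k \<oplus>\<^bsub>A\<^esub> x k) = (\<lambda>k\<in>{..n}. \<zero>\<^bsub>A\<^esub>)"
      by (rule bexI[where x = "\<lambda>k\<in>{..n}. \<ominus>\<^bsub>A\<^esub> x k"])
        (use x in \<open>auto simp: A.l_neg PiE_atMost_mem intro!: restrict_ext\<close>)
    show "(\<lambda>k\<in>{..n}. (\<lambda>k\<in>{..n}. \<zero>\<^bsub>A\<^esub>) k \<oplus>\<^bsub>A\<^esub> x k) = x"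
      by (rule PiE_atMost_eqI[where n = n and X = "carrier A"])
        (use x in \<open>auto simp: PiE_atMost_mem\<close>)
  next
    fix x y z
    assume "x \<in> {..n} \<rightarrow>\<^sub>E carrier A" "y \<in> {..n} \<rightarrow>\<^sub>E carrier A" "z \<in> {..n} \<rightarrow>\<^sub>E carrier A"
    then show "(\<lambda>k\<in>{..n}. (\<lambda>k\<in>{..n}. x k \<oplus>\<^bsub>A\<^esub> y k) k \<oplus>\<^bsub>A\<^esub> z k)
      = (\<lambda>k\<in>{..n}. x k \<oplus>\<^bsub>A\<^esub> (\<lambda>k\<in>{..n}. y k \<oplus>\<^bsub>A\<^esub> z k) k)"
      by (intro restrict_ext) (simp add: A.a_assoc PiE_atMost_mem)
  next
    fix x y
    assume "x \<in> {..n} \<rightarrow>\<^sub>E carrier A" "y \<in> {..n} \<rightarrow>\<^sub>E carrier A"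
    then show "(\<lambda>k\<in>{..n}. x k \<oplus>\<^bsub>A\<^esub> y k) = (\<lambda>k\<in>{..n}. y k \<oplus>\<^bsub>A\<^esub> x k)"
      by (intro restrict_ext) (simp add: A.a_comm PiE_atMost_mem)
  qed auto
qed

context module
begin

lemma smult_finsum:
  assumes "r \<in> carrier R" "\<And>i. i \<in> S \<Longrightarrow> f i \<in> carrier M"
  shows "r \<odot>\<^bsub>M\<^esub> finsum M f S = (\<Oplus>\<^bsub>M\<^esub>i\<in>S. r \<odot>\<^bsub>M\<^esub> f i)"
  by (rule additive_finsum) (use assms in \<open>auto simp: smult_r_distr M.abelian_group_axioms\<close>)

lemma finsum_smult:
  assumes "x \<in> carrier M" "\<And>i. i \<in> S \<Longrightarrow> f i \<in> carrier R"
  shows "finsum R f S \<odot>\<^bsub>M\<^esub> x = (\<Oplus>\<^bsub>M\<^esub>i\<in>S. f i \<odot>\<^bsub>M\<^esub> x)"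
  by (rule additive_finsum[where \<phi> = "\<lambda>r. r \<odot>\<^bsub>M\<^esub> x"])
    (use assms in \<open>auto simp: smult_l_distr M.abelian_group_axioms R.is_abelian_group\<close>)

lemma trunc_module_abelian_group: "abelian_group (trunc_module M n)"
  by (rule pointwise_abelian_group[of M _ n]) (simp_all add: trunc_module_simps M.abelian_group_axioms)

lemma trunc_smult_closed:
  "\<lbrakk>r \<in> carrier (trunc_ring R n); x \<in> carrier (trunc_module M n)\<rbrakk>
    \<Longrightarrow> r \<odot>\<^bsub>trunc_module M n\<^esub> x \<in> carrier (trunc_module M n)"
  by (auto simp: trunc_module_simps trunc_ring_simps PiE_atMost_mem intro!: M.finsum_closed)

lemma trunc_smult_l_distr:
  assumes "r \<in> carrier (trunc_ring R n)" "s \<in> carrier (trunc_ring R n)"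
    "x \<in> carrier (trunc_module M n)"
  shows "(r \<oplus>\<^bsub>trunc_ring R n\<^esub> s) \<odot>\<^bsub>trunc_module M n\<^esub> x
    = r \<odot>\<^bsub>trunc_module M n\<^esub> x \<oplus>\<^bsub>trunc_module M n\<^esub> s \<odot>\<^bsub>trunc_module M n\<^esub> x"
  unfolding trunc_module_simps trunc_ring_simps
proof (rule restrict_ext)
  note mem = assms[unfolded trunc_module_simps trunc_ring_simps, THEN PiE_atMost_mem]
  fix k assume "k \<in> {..n}"
  then have "(\<Oplus>\<^bsub>M\<^esub>i\<in>{..k}. (\<lambda>k\<in>{..n}. r k \<oplus> s k) i \<odot>\<^bsub>M\<^esub> x (k - i))
    = (\<Oplus>\<^bsub>M\<^esub>i\<in>{..k}. r i \<odot>\<^bsub>M\<^esub> x (k - i) \<oplus>\<^bsub>M\<^esub> s i \<odot>\<^bsub>M\<^esub> x (k - i))"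
    by (intro M.finsum_cong') (auto simp: mem smult_l_distr)
  also have "\<dots> = (\<Oplus>\<^bsub>M\<^esub>i\<in>{..k}. r i \<odot>\<^bsub>M\<^esub> x (k - i)) \<oplus>\<^bsub>M\<^esub> (\<Oplus>\<^bsub>M\<^esub>i\<in>{..k}. s i \<odot>\<^bsub>M\<^esub> x (k - i))"
    using \<open>k \<in> {..n}\<close> by (intro M.finsum_addf) (auto simp: mem)
  finally show "(\<Oplus>\<^bsub>M\<^esub>i\<in>{..k}. (\<lambda>k\<in>{..n}. r k \<oplus> s k) i \<odot>\<^bsub>M\<^esub> x (k - i))
    = (\<lambda>k\<in>{..n}. \<Oplus>\<^bsub>M\<^esub>i\<in>{..k}. r i \<odot>\<^bsub>M\<^esub> x (k - i)) k
      \<oplus>\<^bsub>M\<^esub> (\<lambda>k\<in>{..n}. \<Oplus>\<^bsub>M\<^esub>i\<in>{..k}. s i \<odot>\<^bsub>M\<^esub> x (k - i)) k"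
    using \<open>k \<in> {..n}\<close> by simp
qed

lemma trunc_smult_r_distr:
  assumes "r \<in> carrier (trunc_ring R n)" "x \<in> carrier (trunc_module M n)"
    "y \<in> carrier (trunc_module M n)"
  shows "r \<odot>\<^bsub>trunc_module M n\<^esub> (x \<oplus>\<^bsub>trunc_module M n\<^esub> y)
    = r \<odot>\<^bsub>trunc_module M n\<^esub> x \<oplus>\<^bsub>trunc_module M n\<^esub> r \<odot>\<^bsub>trunc_module M n\<^esub> y"
  unfolding trunc_module_simps
proof (rule restrict_ext)
  note mem = assms[unfolded trunc_module_simps trunc_ring_simps, THEN PiE_atMost_mem]
  fix k assume "k \<in> {..n}"
  then have "(\<Oplus>\<^bsub>M\<^esub>i\<in>{..k}. r i \<odot>\<^bsub>M\<^esub> (\<lambda>k\<in>{..n}. x k \<oplus>\<^bsub>M\<^esub> y k) (k - i))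
    = (\<Oplus>\<^bsub>M\<^esub>i\<in>{..k}. r i \<odot>\<^bsub>M\<^esub> x (k - i) \<oplus>\<^bsub>M\<^esub> r i \<odot>\<^bsub>M\<^esub> y (k - i))"
    by (intro M.finsum_cong') (auto simp: mem smult_r_distr)
  also have "\<dots> = (\<Oplus>\<^bsub>M\<^esub>i\<in>{..k}. r i \<odot>\<^bsub>M\<^esub> x (k - i)) \<oplus>\<^bsub>M\<^esub> (\<Oplus>\<^bsub>M\<^esub>i\<in>{..k}. r i \<odot>\<^bsub>M\<^esub> y (k - i))"
    using \<open>k \<in> {..n}\<close> by (intro M.finsum_addf) (auto simp: mem)
  finally show "(\<Oplus>\<^bsub>M\<^esub>i\<in>{..k}. r i \<odot>\<^bsub>M\<^esub> (\<lambda>k\<in>{..n}. x k \<oplus>\<^bsub>M\<^esub> y k) (k - i))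
    = (\<lambda>k\<in>{..n}. \<Oplus>\<^bsub>M\<^esub>i\<in>{..k}. r i \<odot>\<^bsub>M\<^esub> x (k - i)) k
      \<oplus>\<^bsub>M\<^esub> (\<lambda>k\<in>{..n}. \<Oplus>\<^bsub>M\<^esub>i\<in>{..k}. r i \<odot>\<^bsub>M\<^esub> y (k - i)) k"
    using \<open>k \<in> {..n}\<close> by simp
qed

lemma trunc_smult_assoc:
  assumes "r \<in> carrier (trunc_ring R n)" "s \<in> carrier (trunc_ring R n)"
    "x \<in> carrier (trunc_module M n)"
  shows "(r \<otimes>\<^bsub>trunc_ring R n\<^esub> s) \<odot>\<^bsub>trunc_module M n\<^esub> x
    = r \<odot>\<^bsub>trunc_module M n\<^esub> (s \<odot>\<^bsub>trunc_module M n\<^esub> x)"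
  unfolding trunc_module_simps trunc_ring_simps
proof (rule restrict_ext)
  note mem = assms[unfolded trunc_module_simps trunc_ring_simps, THEN PiE_atMost_mem]
  fix k assume k: "k \<in> {..n}"
  then have "(\<Oplus>\<^bsub>M\<^esub>i\<in>{..k}. (\<lambda>k\<in>{..n}. \<Oplus>i\<in>{..k}. r i \<otimes> s (k - i)) i \<odot>\<^bsub>M\<^esub> x (k - i))
    = (\<Oplus>\<^bsub>M\<^esub>i\<in>{..k}. \<Oplus>\<^bsub>M\<^esub>j\<in>{..i}. r j \<odot>\<^bsub>M\<^esub> (s (i - j) \<odot>\<^bsub>M\<^esub> x (k - i)))"
    by (intro M.finsum_cong', simp, force simp: mem intro!: M.finsum_closed)
      (simp, subst finsum_smult, auto simp: mem smult_assoc1 intro!: M.finsum_cong')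
  also have "\<dots> = (\<Oplus>\<^bsub>M\<^esub>i\<in>{..k}. \<Oplus>\<^bsub>M\<^esub>j\<in>{..k - i}. r i \<odot>\<^bsub>M\<^esub> (s j \<odot>\<^bsub>M\<^esub> x (k - i - j)))"
    using k by (intro M.finsum_antidiagonal_assoc) (auto simp: mem)
  also have "\<dots> = (\<Oplus>\<^bsub>M\<^esub>i\<in>{..k}. r i \<odot>\<^bsub>M\<^esub> (\<lambda>k\<in>{..n}. \<Oplus>\<^bsub>M\<^esub>j\<in>{..k}. s j \<odot>\<^bsub>M\<^esub> x (k - j)) (k - i))"
    using k by (intro M.finsum_cong', simp, force simp: mem intro!: M.finsum_closed)
      (simp, subst smult_finsum, auto simp: mem)
  finally show "(\<Oplus>\<^bsub>M\<^esub>i\<in>{..k}. (\<lambda>k\<in>{..n}. \<Oplus>i\<in>{..k}. r i \<otimes> s (k - i)) i \<odot>\<^bsub>M\<^esub> x (k - i))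
    = (\<Oplus>\<^bsub>M\<^esub>i\<in>{..k}. r i \<odot>\<^bsub>M\<^esub> (\<lambda>k\<in>{..n}. \<Oplus>\<^bsub>M\<^esub>j\<in>{..k}. s j \<odot>\<^bsub>M\<^esub> x (k - j)) (k - i))" .
qed

lemma trunc_smult_one:
  assumes "x \<in> carrier (trunc_module M n)"
  shows "\<one>\<^bsub>trunc_ring R n\<^esub> \<odot>\<^bsub>trunc_module M n\<^esub> x = x"
proof -
  note mem = assms[unfolded trunc_module_simps trunc_ring_simps, THEN PiE_atMost_mem]
  have "(\<Oplus>\<^bsub>M\<^esub>i\<in>{..k}. \<one>\<^bsub>trunc_ring R n\<^esub> i \<odot>\<^bsub>M\<^esub> x (k - i)) = x k" if "k \<le> n" for k
    by (subst M.finsum_only[where m = 0]) (use that in \<open>auto simp: mem trunc_ring_simps\<close>)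
  then show ?thesis
    by (intro PiE_atMost_eqI[where n = n and X = "carrier M"])
      (use assms mem in \<open>auto simp: trunc_module_simps\<close>)
qed

end

lemma (in cring) module_self:
  "module R \<lparr>carrier = carrier R, monoid.mult = mult R, one = \<one>, zero = \<zero>, add = add R, smult = mult R\<rparr>"
  (is "module R ?M")
proof (rule moduleI)
  show "abelian_group ?M"
    by (rule abelian_groupI) (auto simp: a_ac intro!: bexI[where x = "\<ominus> _"] l_neg)
qed (auto simp: l_distr r_distr m_assoc is_cring)

text \<open>
  With the ring regarded as a module over itself, multiplication in the truncated ring is scalar
  multiplication in the truncated module.  Associativity, the unit law and one distributive law of
  the ring are then instances of the module laws.
\<close>

lemma (in cring) trunc_ring_cring: "cring (trunc_ring R n)"
proof (rule cringI)
  define M where "M = \<lparr>carrier = carrier R, monoid.mult = mult R, one = \<one>, zero = \<zero>,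
    add = add R, smult = mult R\<rparr>"
  interpret M: module R M
    unfolding M_def by (rule module_self)
  have M_simps: "carrier M = carrier R" "\<zero>\<^bsub>M\<^esub> = \<zero>" "add M = add R" "smult M = mult R"
    by (simp_all add: M_def)
  have finsum_M: "finsum M = finsum R"
    by (simp add: fun_eq_iff finsum_def finprod_def M_simps)
  have T: "carrier (trunc_module M n) = carrier (trunc_ring R n)"
    "add (trunc_module M n) = add (trunc_ring R n)"
    "smult (trunc_module M n) = mult (trunc_ring R n)"
    by (simp_all add: trunc_module_def trunc_ring_def M_simps finsum_M fun_eq_iff)
  show "abelian_group (trunc_ring R n)"
    by (rule pointwise_abelian_group[of R _ n]) (simp_all add: trunc_ring_simps abelian_group_axioms)
  show "comm_monoid (trunc_ring R n)"
  proof (rule comm_monoidI)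
    fix x y assume xy: "x \<in> carrier (trunc_ring R n)" "y \<in> carrier (trunc_ring R n)"
    note mem = xy[unfolded trunc_ring_simps, THEN PiE_atMost_mem]
    have "(\<Oplus>i\<in>{..k}. x i \<otimes> y (k - i)) = (\<Oplus>i\<in>{..k}. y i \<otimes> x (k - i))" if "k \<le> n" for k
      by (subst finsum_antidiagonal_commute[where f = "\<lambda>i j. x i \<otimes> y j"])
        (use that in \<open>auto simp: mem m_comm intro!: finsum_cong'\<close>)
    then show "x \<otimes>\<^bsub>trunc_ring R n\<^esub> y = y \<otimes>\<^bsub>trunc_ring R n\<^esub> x"
      by (auto simp: trunc_ring_simps intro!: restrict_ext)
  qed (use M.trunc_smult_closed[of _ n] M.trunc_smult_assoc[of _ n] M.trunc_smult_one[of _ n] in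
      \<open>auto simp: T trunc_ring_simps(1,3)\<close>)
  show "(x \<oplus>\<^bsub>trunc_ring R n\<^esub> y) \<otimes>\<^bsub>trunc_ring R n\<^esub> z
    = x \<otimes>\<^bsub>trunc_ring R n\<^esub> z \<oplus>\<^bsub>trunc_ring R n\<^esub> y \<otimes>\<^bsub>trunc_ring R n\<^esub> z"
    if "x \<in> carrier (trunc_ring R n)" "y \<in> carrier (trunc_ring R n)"
      "z \<in> carrier (trunc_ring R n)" for x y z
    using M.trunc_smult_l_distr[of x n y z] that by (simp add: T)
qed

lemma (in module) trunc_module_module: "module (trunc_ring R n) (trunc_module M n)"
  by (rule moduleI) (simp_all add: R.trunc_ring_cring trunc_module_abelian_group trunc_smult_closed
      trunc_smult_l_distr trunc_smult_r_distr trunc_smult_assoc trunc_smult_one)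

section \<open>Multiplicative cochains\<close>

lemma hoch_cochainsI:
  assumes "f \<in> tuples A n \<rightarrow>\<^sub>E carrier A"
    and "\<And>xs i x y. \<lbrakk>xs \<in> tuples A n; i < n; x \<in> carrier A; y \<in> carrier A\<rbrakk>
      \<Longrightarrow> f (xs[i := x \<oplus>\<^bsub>A\<^esub> y]) = f (xs[i := x]) \<oplus>\<^bsub>A\<^esub> f (xs[i := y])"
    and "\<And>xs i r x. \<lbrakk>xs \<in> tuples A n; i < n; r \<in> carrier K; x \<in> carrier A\<rbrakk>
      \<Longrightarrow> f (xs[i := r \<odot>\<^bsub>A\<^esub> x]) = r \<odot>\<^bsub>A\<^esub> f (xs[i := x])"
    and "\<And>xs. xs \<in> tuples A n \<Longrightarrow> \<alpha> (f xs) = f (map \<alpha> xs)"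
    and "\<And>xs. xs \<in> tuples A n \<Longrightarrow> \<beta> (f xs) = f (map \<beta> xs)"
  shows "f \<in> hoch_cochains K A \<alpha> \<beta> n"
  unfolding hoch_cochains_def multilinear_maps_def using assms by simp

lemma hoch_cochainsD:
  assumes "f \<in> hoch_cochains K A \<alpha> \<beta> n" "xs \<in> tuples A n"
  shows "f xs \<in> carrier A"
    and "\<lbrakk>i < n; x \<in> carrier A; y \<in> carrier A\<rbrakk>
      \<Longrightarrow> f (xs[i := x \<oplus>\<^bsub>A\<^esub> y]) = f (xs[i := x]) \<oplus>\<^bsub>A\<^esub> f (xs[i := y])"
    and "\<lbrakk>i < n; r \<in> carrier K; x \<in> carrier A\<rbrakk> \<Longrightarrow> f (xs[i := r \<odot>\<^bsub>A\<^esub> x]) = r \<odot>\<^bsub>A\<^esub> f (xs[i := x])"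
    and "\<alpha> (f xs) = f (map \<alpha> xs)"
    and "\<beta> (f xs) = f (map \<beta> xs)"
  using assms unfolding hoch_cochains_def multilinear_maps_def by (auto dest: PiE_mem)

lemma tuples_update: "\<lbrakk>xs \<in> tuples A n; x \<in> carrier A\<rbrakk> \<Longrightarrow> xs[i := x] \<in> tuples A n"
  unfolding tuples_def using set_update_subset_insert[of xs i x] by auto

lemma tuples_map: "\<lbrakk>xs \<in> tuples A n; \<And>x. x \<in> carrier A \<Longrightarrow> \<phi> x \<in> carrier A\<rbrakk> \<Longrightarrow> map \<phi> xs \<in> tuples A n"
  unfolding tuples_def by auto

text \<open>
  The cochain groups and the coefficients of a deformation involve the structure maps \<open>\<alpha>\<close> and \<open>\<beta>\<close>
  but no product, hence this locale without one.
\<close>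

locale bihom_module = module K A for K and A (structure) +
  fixes \<alpha> \<beta> :: "'c \<Rightarrow> 'c"
  assumes alpha_closed: "a \<in> carrier A \<Longrightarrow> \<alpha> a \<in> carrier A"
    and alpha_add: "\<lbrakk>a \<in> carrier A; b \<in> carrier A\<rbrakk> \<Longrightarrow> \<alpha> (a \<oplus> b) = \<alpha> a \<oplus> \<alpha> b"
    and alpha_smult: "\<lbrakk>r \<in> carrier K; a \<in> carrier A\<rbrakk> \<Longrightarrow> \<alpha> (r \<odot> a) = r \<odot> \<alpha> a"
    and beta_closed: "a \<in> carrier A \<Longrightarrow> \<beta> a \<in> carrier A"
    and beta_add: "\<lbrakk>a \<in> carrier A; b \<in> carrier A\<rbrakk> \<Longrightarrow> \<beta> (a \<oplus> b) = \<beta> a \<oplus> \<beta> b"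
    and beta_smult: "\<lbrakk>r \<in> carrier K; a \<in> carrier A\<rbrakk> \<Longrightarrow> \<beta> (r \<odot> a) = r \<odot> \<beta> a"
    and alpha_beta_commute: "a \<in> carrier A \<Longrightarrow> \<alpha> (\<beta> a) = \<beta> (\<alpha> a)"
begin

lemmas additive = additive_finsum[OF M.abelian_group_axioms M.abelian_group_axioms]
lemmas additive_diff = additive_minus[OF M.abelian_group_axioms M.abelian_group_axioms]

lemma alpha_finsum: "(\<And>i. i \<in> S \<Longrightarrow> f i \<in> carrier A) \<Longrightarrow> \<alpha> (finsum A f S) = (\<Oplus>i\<in>S. \<alpha> (f i))"
  by (rule additive) (auto simp: alpha_closed alpha_add)

lemma beta_finsum: "(\<And>i. i \<in> S \<Longrightarrow> f i \<in> carrier A) \<Longrightarrow> \<beta> (finsum A f S) = (\<Oplus>i\<in>S. \<beta> (f i))"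
  by (rule additive) (auto simp: beta_closed beta_add)

lemma minus_add_minus:
  assumes "a \<in> carrier A" "b \<in> carrier A" "c \<in> carrier A" "d \<in> carrier A"
  shows "(a \<oplus> b) \<ominus> (c \<oplus> d) = (a \<ominus> c) \<oplus> (b \<ominus> d)"
  using assms by (simp add: a_minus_def M.minus_add M.a_ac)

lemma smult_minus:
  assumes "r \<in> carrier K" "a \<in> carrier A" "b \<in> carrier A"
  shows "r \<odot> (a \<ominus> b) = r \<odot> a \<ominus> r \<odot> b"
  by (rule additive_diff) (use assms in \<open>auto simp: smult_r_distr\<close>)

lemma cochain_zero: "(\<lambda>xs\<in>tuples A n. \<zero>) \<in> hoch_cochains K A \<alpha> \<beta> n"
proof (rule hoch_cochainsI)
  have "\<alpha> \<zero> = \<zero>" "\<beta> \<zero> = \<zero>"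
    using alpha_finsum[of "{}"] beta_finsum[of "{}"] by auto
  then show "\<alpha> ((\<lambda>xs\<in>tuples A n. \<zero>) xs) = (\<lambda>xs\<in>tuples A n. \<zero>) (map \<alpha> xs)"
    "\<beta> ((\<lambda>xs\<in>tuples A n. \<zero>) xs) = (\<lambda>xs\<in>tuples A n. \<zero>) (map \<beta> xs)"
    if "xs \<in> tuples A n" for xs
    using that by (auto simp: tuples_map alpha_closed beta_closed)
qed (auto simp: tuples_update)

lemma cochain_minus:
  assumes f: "f \<in> hoch_cochains K A \<alpha> \<beta> n" and g: "g \<in> hoch_cochains K A \<alpha> \<beta> n"
  shows "(\<lambda>xs\<in>tuples A n. f xs \<ominus> g xs) \<in> hoch_cochains K A \<alpha> \<beta> n" (is "?h \<in> _")
proof (rule hoch_cochainsI)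
  note F = hoch_cochainsD[OF f] and G = hoch_cochainsD[OF g]
  show "?h \<in> tuples A n \<rightarrow>\<^sub>E carrier A"
    by (auto simp: F(1) G(1))
  fix xs assume xs: "xs \<in> tuples A n"
  show "\<alpha> (?h xs) = ?h (map \<alpha> xs)"
    using xs additive_diff[of \<alpha> "f xs" "g xs"]
    by (auto simp: tuples_map alpha_closed alpha_add F(1,4) G(1,4))
  show "\<beta> (?h xs) = ?h (map \<beta> xs)"
    using xs additive_diff[of \<beta> "f xs" "g xs"]
    by (auto simp: tuples_map beta_closed beta_add F(1,5) G(1,5))
  fix i x y assume i: "i < n" and x: "x \<in> carrier A"
  show "?h (xs[i := r \<odot> x]) = r \<odot> ?h (xs[i := x])" if "r \<in> carrier K" for r
    using xs x i that by (simp add: tuples_update F(1,3) G(1,3) smult_minus)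
  assume y: "y \<in> carrier A"
  show "?h (xs[i := x \<oplus> y]) = ?h (xs[i := x]) \<oplus> ?h (xs[i := y])"
    using xs x y i by (simp add: tuples_update F(1,2) G(1,2) minus_add_minus)
qed

lemma cochain_finsum:
  assumes "\<And>j. j \<in> S \<Longrightarrow> f j \<in> hoch_cochains K A \<alpha> \<beta> n"
  shows "(\<lambda>xs\<in>tuples A n. \<Oplus>j\<in>S. f j xs) \<in> hoch_cochains K A \<alpha> \<beta> n" (is "?h \<in> _")
proof (rule hoch_cochainsI)
  note F = assms[THEN hoch_cochainsD(1)] assms[THEN hoch_cochainsD(2)]
    assms[THEN hoch_cochainsD(3)] assms[THEN hoch_cochainsD(4)] assms[THEN hoch_cochainsD(5)]
  show "?h \<in> tuples A n \<rightarrow>\<^sub>E carrier A"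
    by (auto simp: F(1) intro!: M.finsum_closed)
  fix xs assume xs: "xs \<in> tuples A n"
  show "\<alpha> (?h xs) = ?h (map \<alpha> xs)"
    using xs by (auto simp: tuples_map alpha_closed alpha_finsum F(1,4) intro!: M.finsum_cong')
  show "\<beta> (?h xs) = ?h (map \<beta> xs)"
    using xs by (auto simp: tuples_map beta_closed beta_finsum F(1,5) intro!: M.finsum_cong')
  fix i x y assume i: "i < n" and x: "x \<in> carrier A"
  show "?h (xs[i := r \<odot> x]) = r \<odot> ?h (xs[i := x])" if "r \<in> carrier K" for r
    using xs x i that
    by (auto simp: tuples_update F(1,3) smult_finsum intro!: M.finsum_cong')
  assume y: "y \<in> carrier A"
  have "(\<Oplus>j\<in>S. f j (xs[i := x \<oplus> y])) = (\<Oplus>j\<in>S. f j (xs[i := x]) \<oplus> f j (xs[i := y]))"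
    by (rule M.finsum_cong') (use xs x y i in \<open>auto simp: F(1,2) tuples_update\<close>)
  also have "\<dots> = (\<Oplus>j\<in>S. f j (xs[i := x])) \<oplus> (\<Oplus>j\<in>S. f j (xs[i := y]))"
    by (rule M.finsum_addf) (use xs x y i in \<open>auto simp: F(1) tuples_update\<close>)
  finally show "?h (xs[i := x \<oplus> y]) = ?h (xs[i := x]) \<oplus> ?h (xs[i := y])"
    using xs x y by (simp add: tuples_update)
qed

lemma cochain2:
  assumes f: "f \<in> hoch_cochains K A \<alpha> \<beta> 2"
  shows "\<lbrakk>a \<in> carrier A; b \<in> carrier A\<rbrakk> \<Longrightarrow> f [a, b] \<in> carrier A"
    and "\<lbrakk>a \<in> carrier A; a' \<in> carrier A; b \<in> carrier A\<rbrakk> \<Longrightarrow> f [a \<oplus> a', b] = f [a, b] \<oplus> f [a', b]"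
    and "\<lbrakk>a \<in> carrier A; b \<in> carrier A; b' \<in> carrier A\<rbrakk> \<Longrightarrow> f [a, b \<oplus> b'] = f [a, b] \<oplus> f [a, b']"
    and "\<lbrakk>r \<in> carrier K; a \<in> carrier A; b \<in> carrier A\<rbrakk> \<Longrightarrow> f [r \<odot> a, b] = r \<odot> f [a, b]"
    and "\<lbrakk>r \<in> carrier K; a \<in> carrier A; b \<in> carrier A\<rbrakk> \<Longrightarrow> f [a, r \<odot> b] = r \<odot> f [a, b]"
    and "\<lbrakk>a \<in> carrier A; b \<in> carrier A\<rbrakk> \<Longrightarrow> \<alpha> (f [a, b]) = f [\<alpha> a, \<alpha> b]"
    and "\<lbrakk>a \<in> carrier A; b \<in> carrier A\<rbrakk> \<Longrightarrow> \<beta> (f [a, b]) = f [\<beta> a, \<beta> b]"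
proof -
  have ab: "[a, b] \<in> tuples A 2" if "a \<in> carrier A" "b \<in> carrier A" for a b
    using that by (simp add: tuples_def)
  note F = hoch_cochainsD[OF f ab]
  show "\<lbrakk>a \<in> carrier A; b \<in> carrier A\<rbrakk> \<Longrightarrow> f [a, b] \<in> carrier A"
    "\<lbrakk>a \<in> carrier A; b \<in> carrier A\<rbrakk> \<Longrightarrow> \<alpha> (f [a, b]) = f [\<alpha> a, \<alpha> b]"
    "\<lbrakk>a \<in> carrier A; b \<in> carrier A\<rbrakk> \<Longrightarrow> \<beta> (f [a, b]) = f [\<beta> a, \<beta> b]"
    using F(1,4,5)[of a b] by auto
  show "\<lbrakk>a \<in> carrier A; a' \<in> carrier A; b \<in> carrier A\<rbrakk> \<Longrightarrow> f [a \<oplus> a', b] = f [a, b] \<oplus> f [a', b]"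
    using F(2)[of a b 0 a a'] by simp
  show "\<lbrakk>a \<in> carrier A; b \<in> carrier A; b' \<in> carrier A\<rbrakk> \<Longrightarrow> f [a, b \<oplus> b'] = f [a, b] \<oplus> f [a, b']"
    using F(2)[of a b 1 b b'] by simp
  show "\<lbrakk>r \<in> carrier K; a \<in> carrier A; b \<in> carrier A\<rbrakk> \<Longrightarrow> f [r \<odot> a, b] = r \<odot> f [a, b]"
    using F(3)[of a b 0 r a] by simp
  show "\<lbrakk>r \<in> carrier K; a \<in> carrier A; b \<in> carrier A\<rbrakk> \<Longrightarrow> f [a, r \<odot> b] = r \<odot> f [a, b]"
    using F(3)[of a b 1 r b] by simp
qed

end

section \<open>Products of power series\<close>

text \<open>
  For \<open>\<mu>\<^sub>t = \<Sum>\<^sub>i m\<^sub>i t\<^sup>i\<close>, the following are the coefficients of \<open>t\<^sup>s\<close> in \<open>\<mu>\<^sub>t(\<mu>\<^sub>t(a, b), \<beta> c)\<close> and in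
  \<open>\<mu>\<^sub>t(\<alpha> a, \<mu>\<^sub>t(b, c))\<close> for \<open>a\<close>, \<open>b\<close>, \<open>c\<close> of degree \<open>0\<close> in \<open>t\<close>.
\<close>

definition left_coeff ::
  "('k, 'a, 'n) module_scheme \<Rightarrow> ('a \<Rightarrow> 'a) \<Rightarrow> (nat \<Rightarrow> 'a list \<Rightarrow> 'a) \<Rightarrow> nat \<Rightarrow> 'a \<Rightarrow> 'a \<Rightarrow> 'a \<Rightarrow> 'a" where
  "left_coeff A \<beta> m s a b c = (\<Oplus>\<^bsub>A\<^esub>i\<in>{..s}. m i [m (s - i) [a, b], \<beta> c])"

definition right_coeff ::
  "('k, 'a, 'n) module_scheme \<Rightarrow> ('a \<Rightarrow> 'a) \<Rightarrow> (nat \<Rightarrow> 'a list \<Rightarrow> 'a) \<Rightarrow> nat \<Rightarrow> 'a \<Rightarrow> 'a \<Rightarrow> 'a \<Rightarrow> 'a" where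
  "right_coeff A \<alpha> m s a b c = (\<Oplus>\<^bsub>A\<^esub>i\<in>{..s}. m i [\<alpha> a, m (s - i) [b, c]])"

text \<open>
  The coefficients are required to be cochains only up to \<open>N\<close>, since a deformation leaves the others
  arbitrary.
\<close>

locale product_family = bihom_module +
  fixes N :: nat and m :: "nat \<Rightarrow> 'c list \<Rightarrow> 'c"
  assumes cochain: "i \<le> N \<Longrightarrow> m i \<in> hoch_cochains K A \<alpha> \<beta> 2"
begin

lemmas m_closed = cochain[THEN cochain2(1)]
lemmas m_add_left = cochain[THEN cochain2(2)]
lemmas m_add_right = cochain[THEN cochain2(3)]
lemmas m_smult_left = cochain[THEN cochain2(4)]
lemmas m_smult_right = cochain[THEN cochain2(5)]
lemmas alpha_m = cochain[THEN cochain2(6)]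
lemmas beta_m = cochain[THEN cochain2(7)]

lemma m_finsum_left:
  "\<lbrakk>i \<le> N; b \<in> carrier A; \<And>j. j \<in> S \<Longrightarrow> f j \<in> carrier A\<rbrakk>
    \<Longrightarrow> m i [finsum A f S, b] = (\<Oplus>j\<in>S. m i [f j, b])"
  by (rule additive[where \<phi> = "\<lambda>a. m i [a, b]"]) (auto simp: m_closed m_add_left)

lemma m_finsum_right:
  "\<lbrakk>i \<le> N; a \<in> carrier A; \<And>j. j \<in> S \<Longrightarrow> f j \<in> carrier A\<rbrakk>
    \<Longrightarrow> m i [a, finsum A f S] = (\<Oplus>j\<in>S. m i [a, f j])"
  by (rule additive[where \<phi> = "\<lambda>b. m i [a, b]"]) (auto simp: m_closed m_add_right)

lemma m_minus_left:
  "\<lbrakk>i \<le> N; a \<in> carrier A; a' \<in> carrier A; b \<in> carrier A\<rbrakk>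
    \<Longrightarrow> m i [a \<ominus> a', b] = m i [a, b] \<ominus> m i [a', b]"
  by (rule additive_diff[where \<phi> = "\<lambda>a. m i [a, b]"]) (auto simp: m_closed m_add_left)

lemma m_minus_right:
  "\<lbrakk>i \<le> N; a \<in> carrier A; b \<in> carrier A; b' \<in> carrier A\<rbrakk>
    \<Longrightarrow> m i [a, b \<ominus> b'] = m i [a, b] \<ominus> m i [a, b']"
  by (rule additive_diff[where \<phi> = "\<lambda>b. m i [a, b]"]) (auto simp: m_closed m_add_right)

lemma m_zero_left: "\<lbrakk>i \<le> N; b \<in> carrier A\<rbrakk> \<Longrightarrow> m i [\<zero>, b] = \<zero>"
  and m_zero_right: "\<lbrakk>i \<le> N; b \<in> carrier A\<rbrakk> \<Longrightarrow> m i [b, \<zero>] = \<zero>"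
  using m_finsum_left[of i b "{}"] m_finsum_right[of i b "{}"] by auto

lemma left_coeff_closed:
  "\<lbrakk>s \<le> N; a \<in> carrier A; b \<in> carrier A; c \<in> carrier A\<rbrakk> \<Longrightarrow> left_coeff A \<beta> m s a b c \<in> carrier A"
  unfolding left_coeff_def by (auto simp: m_closed beta_closed intro!: M.finsum_closed)

lemma right_coeff_closed:
  "\<lbrakk>s \<le> N; a \<in> carrier A; b \<in> carrier A; c \<in> carrier A\<rbrakk> \<Longrightarrow> right_coeff A \<alpha> m s a b c \<in> carrier A"
  unfolding right_coeff_def by (auto simp: m_closed alpha_closed intro!: M.finsum_closed)

abbreviation series :: "(nat \<Rightarrow> 'c) set" where
  "series \<equiv> {..N} \<rightarrow>\<^sub>E carrier A"

abbreviation ext :: "(nat \<Rightarrow> 'c) \<Rightarrow> (nat \<Rightarrow> 'c) \<Rightarrow> nat \<Rightarrow> 'c" where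
  "ext \<equiv> trunc_bilinear_ext A N m"

abbreviation pairs :: "nat \<Rightarrow> (nat \<times> nat) set" where
  "pairs k \<equiv> Sigma {..k} (\<lambda>i. {..k - i})"

lemma ext_eq_pairs:
  assumes "x \<in> series" "y \<in> series" "k \<le> N"
  shows "ext x y k = finsum A (\<lambda>(i, j). m i [x j, y (k - i - j)]) (pairs k)"
proof -
  note mem = assms(1,2)[THEN PiE_atMost_mem]
  have "ext x y k = (\<Oplus>i\<in>{..k}. \<Oplus>j\<in>{..k - i}. m i [x j, y (k - i - j)])"
    using assms by (simp add: trunc_bilinear_ext_def)
  also have "\<dots> = finsum A (\<lambda>(i, j). m i [x j, y (k - i - j)]) (pairs k)"
    by (rule M.finsum_Sigma) (use assms in \<open>auto simp: mem intro!: m_closed\<close>)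
  finally show ?thesis .
qed

lemma ext_closed:
  assumes "x \<in> series" "y \<in> series"
  shows "ext x y \<in> series"
  using assms assms[THEN PiE_atMost_mem]
  by (auto simp: trunc_bilinear_ext_def intro!: m_closed M.finsum_closed)

lemma linear_ext_closed:
  assumes "x \<in> series" "\<And>a. a \<in> carrier A \<Longrightarrow> \<phi> a \<in> carrier A"
  shows "trunc_linear_ext N \<phi> x \<in> series"
  using assms by (auto simp: trunc_linear_ext_def)

lemma ext_add_left:
  assumes "x \<in> series" "x' \<in> series" "y \<in> series"
  shows "ext (x \<oplus>\<^bsub>trunc_module A N\<^esub> x') y = ext x y \<oplus>\<^bsub>trunc_module A N\<^esub> ext x' y"
proof -
  note mem = assms[THEN PiE_atMost_mem]
  have xx: "x \<oplus>\<^bsub>trunc_module A N\<^esub> x' \<in> series"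
    using mem by (auto simp: trunc_module_simps)
  have "ext (x \<oplus>\<^bsub>trunc_module A N\<^esub> x') y k = ext x y k \<oplus> ext x' y k" if k: "k \<le> N" for k
  proof -
    have "ext (x \<oplus>\<^bsub>trunc_module A N\<^esub> x') y k
      = finsum A (\<lambda>p. (\<lambda>(i, j). m i [x j, y (k - i - j)]) p
          \<oplus> (\<lambda>(i, j). m i [x' j, y (k - i - j)]) p) (pairs k)"
      unfolding ext_eq_pairs[OF xx assms(3) k]
      by (rule M.finsum_cong') (use k in \<open>auto simp: mem m_closed m_add_left trunc_module_simps\<close>)
    also have "\<dots> = ext x y k \<oplus> ext x' y k"
      unfolding ext_eq_pairs[OF assms(1,3) k] ext_eq_pairs[OF assms(2,3) k]
      by (rule M.finsum_addf) (use k in \<open>auto simp: mem m_closed\<close>)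
    finally show ?thesis .
  qed
  then show ?thesis
    by (intro PiE_atMost_eqI[where n = N and X = "carrier A"])
      (use xx assms ext_closed[THEN PiE_atMost_mem] in \<open>auto simp: ext_closed trunc_module_simps\<close>)
qed

lemma ext_add_right:
  assumes "x \<in> series" "y \<in> series" "y' \<in> series"
  shows "ext x (y \<oplus>\<^bsub>trunc_module A N\<^esub> y') = ext x y \<oplus>\<^bsub>trunc_module A N\<^esub> ext x y'"
proof -
  note mem = assms[THEN PiE_atMost_mem]
  have yy: "y \<oplus>\<^bsub>trunc_module A N\<^esub> y' \<in> series"
    using mem by (auto simp: trunc_module_simps)
  have "ext x (y \<oplus>\<^bsub>trunc_module A N\<^esub> y') k = ext x y k \<oplus> ext x y' k" if k: "k \<le> N" for k
  proof -
    have "ext x (y \<oplus>\<^bsub>trunc_module A N\<^esub> y') k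
      = finsum A (\<lambda>p. (\<lambda>(i, j). m i [x j, y (k - i - j)]) p
          \<oplus> (\<lambda>(i, j). m i [x j, y' (k - i - j)]) p) (pairs k)"
      unfolding ext_eq_pairs[OF assms(1) yy k]
      by (rule M.finsum_cong') (use k in \<open>auto simp: mem m_closed m_add_right trunc_module_simps\<close>)
    also have "\<dots> = ext x y k \<oplus> ext x y' k"
      unfolding ext_eq_pairs[OF assms(1,2) k] ext_eq_pairs[OF assms(1,3) k]
      by (rule M.finsum_addf) (use k in \<open>auto simp: mem m_closed\<close>)
    finally show ?thesis .
  qed
  then show ?thesis
    by (intro PiE_atMost_eqI[where n = N and X = "carrier A"])
      (use yy assms ext_closed[THEN PiE_atMost_mem] in \<open>auto simp: ext_closed trunc_module_simps\<close>)
qed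

lemma smult_ext_nth:
  assumes "r \<in> {..N} \<rightarrow>\<^sub>E carrier K" "x \<in> series" "y \<in> series" "k \<le> N"
  shows "(r \<odot>\<^bsub>trunc_module A N\<^esub> ext x y) k
    = (\<Oplus>p\<in>{..k}. finsum A (\<lambda>(i, j). r p \<odot> m i [x j, y (k - p - i - j)]) (pairs (k - p)))"
proof -
  note mem = assms(1-3)[THEN PiE_atMost_mem]
  have "r p \<odot> ext x y (k - p)
    = finsum A (\<lambda>(i, j). r p \<odot> m i [x j, y (k - p - i - j)]) (pairs (k - p))" if "p \<le> k" for p
  proof -
    have "r p \<odot> ext x y (k - p)
      = finsum A (\<lambda>q. r p \<odot> (\<lambda>(i, j). m i [x j, y (k - p - i - j)]) q) (pairs (k - p))"
      using assms that
      by (subst ext_eq_pairs, simp_all, subst smult_finsum) (auto simp: mem m_closed)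
    also have "\<dots> = finsum A (\<lambda>(i, j). r p \<odot> m i [x j, y (k - p - i - j)]) (pairs (k - p))"
      by (rule M.finsum_cong') (use assms that in \<open>auto simp: mem m_closed\<close>)
    finally show ?thesis .
  qed
  moreover have "(r \<odot>\<^bsub>trunc_module A N\<^esub> ext x y) k = (\<Oplus>p\<in>{..k}. r p \<odot> ext x y (k - p))"
    using assms by (simp add: trunc_module_simps)
  ultimately show ?thesis
    using assms by (auto simp: mem m_closed intro!: M.finsum_cong' M.finsum_closed)
qed

lemma ext_smult_left:
  assumes "r \<in> {..N} \<rightarrow>\<^sub>E carrier K" "x \<in> series" "y \<in> series"
  shows "ext (r \<odot>\<^bsub>trunc_module A N\<^esub> x) y = r \<odot>\<^bsub>trunc_module A N\<^esub> ext x y"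
proof (rule PiE_atMost_eqI[where n = N and X = "carrier A"])
  note mem = assms[THEN PiE_atMost_mem]
  have rx: "r \<odot>\<^bsub>trunc_module A N\<^esub> x \<in> series"
    using mem by (auto simp: trunc_module_simps intro!: M.finsum_closed)
  then show "ext (r \<odot>\<^bsub>trunc_module A N\<^esub> x) y \<in> series"
    using assms by (auto intro!: ext_closed)
  show "r \<odot>\<^bsub>trunc_module A N\<^esub> ext x y \<in> series"
    using mem ext_closed[OF assms(2,3), THEN PiE_atMost_mem]
    by (auto simp: trunc_module_simps intro!: M.finsum_closed)
  fix k assume k: "k \<le> N"
  have "ext (r \<odot>\<^bsub>trunc_module A N\<^esub> x) y k
    = (\<Oplus>q\<in>pairs k. \<Oplus>p\<in>{..snd q}. r p \<odot> m (fst q) [x (snd q - p), y (k - fst q - snd q)])"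
    unfolding ext_eq_pairs[OF rx assms(3) k]
  proof (rule M.finsum_cong', simp)
    fix q assume "q \<in> pairs k"
    then show "(\<lambda>(i, j). m i [(r \<odot>\<^bsub>trunc_module A N\<^esub> x) j, y (k - i - j)]) q
      = (\<Oplus>p\<in>{..snd q}. r p \<odot> m (fst q) [x (snd q - p), y (k - fst q - snd q)])"
      using k by (cases q) (simp add: trunc_module_simps, subst m_finsum_left,
          auto simp: mem m_closed m_smult_left intro!: M.finsum_cong')
  qed (use k in \<open>auto simp: mem m_closed intro!: M.finsum_closed\<close>)
  also have "\<dots> = (\<Oplus>p\<in>{..k}. \<Oplus>q\<in>pairs (k - p). r p \<odot> m (fst q) [x (snd q), y (k - p - fst q - snd q)])"
    by (rule M.finsum_nested_reindex[where h = "\<lambda>((i, j), p). (p, (i, j - p))"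
          and h' = "\<lambda>(p, (i, j)). ((i, j + p), p)"])
      (use k in \<open>auto simp: mem m_closed\<close>)
  also have "\<dots> = (r \<odot>\<^bsub>trunc_module A N\<^esub> ext x y) k"
    unfolding smult_ext_nth[OF assms k] by (simp add: case_prod_beta')
  finally show "ext (r \<odot>\<^bsub>trunc_module A N\<^esub> x) y k = (r \<odot>\<^bsub>trunc_module A N\<^esub> ext x y) k" .
qed

lemma ext_smult_right:
  assumes "r \<in> {..N} \<rightarrow>\<^sub>E carrier K" "x \<in> series" "y \<in> series"
  shows "ext x (r \<odot>\<^bsub>trunc_module A N\<^esub> y) = r \<odot>\<^bsub>trunc_module A N\<^esub> ext x y"
proof (rule PiE_atMost_eqI[where n = N and X = "carrier A"])
  note mem = assms[THEN PiE_atMost_mem]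
  have ry: "r \<odot>\<^bsub>trunc_module A N\<^esub> y \<in> series"
    using mem by (auto simp: trunc_module_simps intro!: M.finsum_closed)
  then show "ext x (r \<odot>\<^bsub>trunc_module A N\<^esub> y) \<in> series"
    using assms by (auto intro!: ext_closed)
  show "r \<odot>\<^bsub>trunc_module A N\<^esub> ext x y \<in> series"
    using mem ext_closed[OF assms(2,3), THEN PiE_atMost_mem]
    by (auto simp: trunc_module_simps intro!: M.finsum_closed)
  fix k assume k: "k \<le> N"
  have "ext x (r \<odot>\<^bsub>trunc_module A N\<^esub> y) k
    = (\<Oplus>q\<in>pairs k. \<Oplus>p\<in>{..k - fst q - snd q}. r p \<odot> m (fst q) [x (snd q), y (k - fst q - snd q - p)])"
    unfolding ext_eq_pairs[OF assms(2) ry k]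
  proof (rule M.finsum_cong', simp)
    fix q assume "q \<in> pairs k"
    then show "(\<lambda>(i, j). m i [x j, (r \<odot>\<^bsub>trunc_module A N\<^esub> y) (k - i - j)]) q
      = (\<Oplus>p\<in>{..k - fst q - snd q}. r p \<odot> m (fst q) [x (snd q), y (k - fst q - snd q - p)])"
      using k by (cases q) (simp add: trunc_module_simps, subst m_finsum_right,
          auto simp: mem m_closed m_smult_right intro!: M.finsum_cong')
  qed (use k in \<open>auto simp: mem m_closed intro!: M.finsum_closed\<close>)
  also have "\<dots> = (\<Oplus>p\<in>{..k}. \<Oplus>q\<in>pairs (k - p). r p \<odot> m (fst q) [x (snd q), y (k - p - fst q - snd q)])"
    by (rule M.finsum_nested_reindex[where h = "\<lambda>((i, j), p). (p, (i, j))"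
          and h' = "\<lambda>(p, (i, j)). ((i, j), p)"])
      (use k in \<open>auto simp: mem m_closed add_ac\<close>)
  also have "\<dots> = (r \<odot>\<^bsub>trunc_module A N\<^esub> ext x y) k"
    unfolding smult_ext_nth[OF assms k] by (simp add: case_prod_beta')
  finally show "ext x (r \<odot>\<^bsub>trunc_module A N\<^esub> y) k = (r \<odot>\<^bsub>trunc_module A N\<^esub> ext x y) k" .
qed

abbreviation triples :: "nat \<Rightarrow> (nat \<times> nat \<times> nat) set" where
  "triples k \<equiv> {(a, b, c). a + b + c \<le> k}"

lemma finite_triples: "finite (triples k)"
  by (rule finite_subset[of _ "{..k} \<times> {..k} \<times> {..k}"]) auto

text \<open>
  Collecting the terms of the nested sums by the degrees \<open>a\<close>, \<open>b\<close>, \<open>c\<close> of the coefficients of the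
  three series: the remaining degree \<open>k - a - b - c\<close> is shared between the two product maps.  Thus the
  two bracketings of series are built from those of elements of \<open>A\<close> in the same way, which reduces
  associativity for series to elements of \<open>A\<close>.
\<close>

lemma ext_left_product:
  assumes "x \<in> series" "y \<in> series" "z \<in> series" "k \<le> N"
  shows "ext (ext x y) (trunc_linear_ext N \<beta> z) k
    = finsum A (\<lambda>(a, b, c). left_coeff A \<beta> m (k - a - b - c) (x a) (y b) (z c)) (triples k)"
proof -
  note mem = assms(1-3)[THEN PiE_atMost_mem]
  have z: "trunc_linear_ext N \<beta> z \<in> series"
    by (rule linear_ext_closed) (use assms beta_closed in blast)+
  have "ext (ext x y) (trunc_linear_ext N \<beta> z) k
    = (\<Oplus>p\<in>pairs k. \<Oplus>q\<in>pairs (snd p).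
        m (fst p) [m (fst q) [x (snd q), y (snd p - fst q - snd q)], \<beta> (z (k - fst p - snd p))])"
    unfolding ext_eq_pairs[OF ext_closed[OF assms(1,2)] z assms(4)]
  proof (rule M.finsum_cong', simp)
    fix p assume "p \<in> pairs k"
    then obtain i j where p: "p = (i, j)" and ij: "i \<le> k" "j \<le> k - i"
      by auto
    then have "m i [ext x y j, \<beta> (z (k - i - j))]
      = (\<Oplus>q\<in>pairs j. m i [(\<lambda>(i, l). m i [x l, y (j - i - l)]) q, \<beta> (z (k - i - j))])"
      using assms ij
      by (simp add: ext_eq_pairs, intro m_finsum_left) (auto simp: mem m_closed beta_closed)
    moreover have "k - (i + j) \<le> N"
      using assms(4) by simp
    ultimately show "(\<lambda>(i, j). m i [ext x y j, trunc_linear_ext N \<beta> z (k - i - j)]) p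
      = (\<Oplus>q\<in>pairs (snd p).
        m (fst p) [m (fst q) [x (snd q), y (snd p - fst q - snd q)], \<beta> (z (k - fst p - snd p))])"
      using p ij by (simp add: trunc_linear_ext_def case_prod_beta')
  qed (use assms(4) in \<open>auto simp: mem m_closed beta_closed intro!: M.finsum_closed\<close>)
  also have "\<dots> = (\<Oplus>t\<in>triples k. \<Oplus>i\<in>{..k - fst t - fst (snd t) - snd (snd t)}.
      m i [m (k - fst t - fst (snd t) - snd (snd t) - i) [x (fst t), y (fst (snd t))],
        \<beta> (z (snd (snd t)))])"
    by (rule M.finsum_nested_reindex[where h = "\<lambda>((i, j), p, q). ((q, j - p - q, k - i - j), i)"
          and h' = "\<lambda>((a, b, c), i). ((i, k - i - c), (k - a - b - c - i, a))"])
      (use assms(4) in \<open>auto simp: mem m_closed beta_closed finite_triples finite_triples[unfolded add.assoc] add_ac\<close>)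
  also have "\<dots> = finsum A (\<lambda>(a, b, c). left_coeff A \<beta> m (k - a - b - c) (x a) (y b) (z c)) (triples k)"
    by (simp add: left_coeff_def case_prod_beta')
  finally show ?thesis .
qed

lemma ext_right_product:
  assumes "x \<in> series" "y \<in> series" "z \<in> series" "k \<le> N"
  shows "ext (trunc_linear_ext N \<alpha> x) (ext y z) k
    = finsum A (\<lambda>(a, b, c). right_coeff A \<alpha> m (k - a - b - c) (x a) (y b) (z c)) (triples k)"
proof -
  note mem = assms(1-3)[THEN PiE_atMost_mem]
  have x: "trunc_linear_ext N \<alpha> x \<in> series"
    by (rule linear_ext_closed) (use assms alpha_closed in blast)+
  have "ext (trunc_linear_ext N \<alpha> x) (ext y z) k
    = (\<Oplus>p\<in>pairs k. \<Oplus>q\<in>pairs (k - fst p - snd p).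
        m (fst p) [\<alpha> (x (snd p)), m (fst q) [y (snd q), z (k - fst p - snd p - fst q - snd q)]])"
    unfolding ext_eq_pairs[OF x ext_closed[OF assms(2,3)] assms(4)]
  proof (rule M.finsum_cong', simp)
    fix p assume "p \<in> pairs k"
    then show "(\<lambda>(i, j). m i [trunc_linear_ext N \<alpha> x j, ext y z (k - i - j)]) p
      = (\<Oplus>q\<in>pairs (k - fst p - snd p).
        m (fst p) [\<alpha> (x (snd p)), m (fst q) [y (snd q), z (k - fst p - snd p - fst q - snd q)]])"
      using assms by (cases p) (simp add: ext_eq_pairs trunc_linear_ext_def, subst m_finsum_right,
          auto simp: mem m_closed alpha_closed case_prod_beta' intro!: M.finsum_cong')
  qed (use assms(4) in \<open>auto simp: mem m_closed alpha_closed intro!: M.finsum_closed\<close>)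
  also have "\<dots> = (\<Oplus>t\<in>triples k. \<Oplus>i\<in>{..k - fst t - fst (snd t) - snd (snd t)}.
      m i [\<alpha> (x (fst t)), m (k - fst t - fst (snd t) - snd (snd t) - i)
        [y (fst (snd t)), z (snd (snd t))]])"
    by (rule M.finsum_nested_reindex[where h = "\<lambda>((i, j), p, q). ((j, q, k - i - j - p - q), i)"
          and h' = "\<lambda>((a, b, c), i). ((i, a), (k - a - b - c - i, b))"])
      (use assms(4) in \<open>auto simp: mem m_closed alpha_closed finite_triples finite_triples[unfolded add.assoc] add_ac\<close>)
  also have "\<dots> = finsum A (\<lambda>(a, b, c). right_coeff A \<alpha> m (k - a - b - c) (x a) (y b) (z c)) (triples k)"
    by (simp add: right_coeff_def case_prod_beta')
  finally show ?thesis .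
qed

lemma left_coeff_zero:
  assumes "s \<le> N" "a \<in> carrier A" "b \<in> carrier A"
  shows "left_coeff A \<beta> m s \<zero> a b = \<zero>" "left_coeff A \<beta> m s a \<zero> b = \<zero>"
    "left_coeff A \<beta> m s a b \<zero> = \<zero>"
  using assms beta_finsum[of "{}"] unfolding left_coeff_def
  by (auto simp: m_zero_left m_zero_right m_closed beta_closed intro!: M.add.finprod_one_eqI)

lemma right_coeff_zero:
  assumes "s \<le> N" "a \<in> carrier A" "b \<in> carrier A"
  shows "right_coeff A \<alpha> m s \<zero> a b = \<zero>" "right_coeff A \<alpha> m s a \<zero> b = \<zero>"
    "right_coeff A \<alpha> m s a b \<zero> = \<zero>"
  using assms alpha_finsum[of "{}"] unfolding right_coeff_def
  by (auto simp: m_zero_left m_zero_right m_closed alpha_closed intro!: M.add.finprod_one_eqI)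

abbreviation const :: "'c \<Rightarrow> nat \<Rightarrow> 'c" where
  "const a \<equiv> (\<lambda>k\<in>{..N}. if k = 0 then a else \<zero>)"

text \<open>
  In one direction the equations for elements are read off from constant series; in the other they
  give equality of the sums term by term.
\<close>

lemma ext_assoc_iff:
  "(\<forall>x\<in>series. \<forall>y\<in>series. \<forall>z\<in>series.
      ext (trunc_linear_ext N \<alpha> x) (ext y z) = ext (ext x y) (trunc_linear_ext N \<beta> z))
    \<longleftrightarrow> (\<forall>s\<le>N. \<forall>a\<in>carrier A. \<forall>b\<in>carrier A. \<forall>c\<in>carrier A.
      left_coeff A \<beta> m s a b c = right_coeff A \<alpha> m s a b c)" (is "?L \<longleftrightarrow> ?R")
proof
  assume L: ?L
  show ?R
  proof (intro allI impI ballI)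
    fix s a b c
    assume s: "s \<le> N" and abc: "a \<in> carrier A" "b \<in> carrier A" "c \<in> carrier A"
    have const: "const a \<in> series" if "a \<in> carrier A" for a
      using that by auto
    have "left_coeff A \<beta> m s a b c = ext (ext (const a) (const b)) (trunc_linear_ext N \<beta> (const c)) s"
      unfolding ext_left_product[OF const const const s, OF abc]
      by (subst M.finsum_only[where m = "(0, 0, 0)"])
        (use s abc in \<open>auto simp: finite_triples left_coeff_zero left_coeff_closed split: if_splits\<close>)
    also have "\<dots> = ext (trunc_linear_ext N \<alpha> (const a)) (ext (const b) (const c)) s"
      using L const abc by simp
    also have "\<dots> = right_coeff A \<alpha> m s a b c"
      unfolding ext_right_product[OF const const const s, OF abc]
      by (subst M.finsum_only[where m = "(0, 0, 0)"])
        (use s abc in \<open>auto simp: finite_triples right_coeff_zero right_coeff_closed split: if_splits\<close>)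
    finally show "left_coeff A \<beta> m s a b c = right_coeff A \<alpha> m s a b c" .
  qed
next
  assume R: ?R
  show ?L
  proof (intro ballI PiE_atMost_eqI[where n = N and X = "carrier A"])
    fix x y z k assume xyz: "x \<in> series" "y \<in> series" "z \<in> series"
    note mem = xyz[THEN PiE_atMost_mem]
    show "ext (trunc_linear_ext N \<alpha> x) (ext y z) \<in> series"
      "ext (ext x y) (trunc_linear_ext N \<beta> z) \<in> series"
      using xyz by (auto intro!: ext_closed linear_ext_closed alpha_closed beta_closed)
    assume k: "k \<le> N"
    show "ext (trunc_linear_ext N \<alpha> x) (ext y z) k = ext (ext x y) (trunc_linear_ext N \<beta> z) k"
      unfolding ext_left_product[OF xyz k] ext_right_product[OF xyz k]
      by (rule M.finsum_cong') (use R k mem in \<open>auto simp: left_coeff_closed\<close>)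
  qed
qed

text \<open>
  The map \<open>\<phi>\<close> stands for either of \<open>\<alpha>\<close> and \<open>\<beta>\<close>.
\<close>

lemma linear_ext_ext:
  assumes xy: "x \<in> series" "y \<in> series"
    and closed: "\<And>a. a \<in> carrier A \<Longrightarrow> \<phi> a \<in> carrier A"
    and add: "\<And>a b. \<lbrakk>a \<in> carrier A; b \<in> carrier A\<rbrakk> \<Longrightarrow> \<phi> (a \<oplus> b) = \<phi> a \<oplus> \<phi> b"
    and m: "\<And>i a b. \<lbrakk>i \<le> N; a \<in> carrier A; b \<in> carrier A\<rbrakk> \<Longrightarrow> \<phi> (m i [a, b]) = m i [\<phi> a, \<phi> b]"
  shows "trunc_linear_ext N \<phi> (ext x y) = ext (trunc_linear_ext N \<phi> x) (trunc_linear_ext N \<phi> y)"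
proof (rule PiE_atMost_eqI[where n = N and X = "carrier A"])
  note mem = xy[THEN PiE_atMost_mem]
  have lin: "trunc_linear_ext N \<phi> x \<in> series" "trunc_linear_ext N \<phi> y \<in> series"
    by (rule linear_ext_closed; use xy closed in blast)+
  then show "ext (trunc_linear_ext N \<phi> x) (trunc_linear_ext N \<phi> y) \<in> series"
    "trunc_linear_ext N \<phi> (ext x y) \<in> series"
    using xy closed by (auto intro!: ext_closed linear_ext_closed)
  fix k assume k: "k \<le> N"
  have "\<phi> (ext x y k) = (\<Oplus>p\<in>pairs k. \<phi> ((\<lambda>(i, j). m i [x j, y (k - i - j)]) p))"
    unfolding ext_eq_pairs[OF xy k]
    by (rule additive) (use closed add k in \<open>auto simp: mem m_closed\<close>)
  also have "\<dots> = ext (trunc_linear_ext N \<phi> x) (trunc_linear_ext N \<phi> y) k"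
    unfolding ext_eq_pairs[OF lin k]
    by (rule M.finsum_cong')
      (use k in \<open>auto simp: mem m m_closed closed trunc_linear_ext_def\<close>)
  finally show "trunc_linear_ext N \<phi> (ext x y) k
    = ext (trunc_linear_ext N \<phi> x) (trunc_linear_ext N \<phi> y) k"
    using k by (simp add: trunc_linear_ext_def)
qed

lemma linear_ext_linear:
  assumes closed: "\<And>a. a \<in> carrier A \<Longrightarrow> \<phi> a \<in> carrier A"
    and add: "\<And>a b. \<lbrakk>a \<in> carrier A; b \<in> carrier A\<rbrakk> \<Longrightarrow> \<phi> (a \<oplus> b) = \<phi> a \<oplus> \<phi> b"
    and smult: "\<And>r a. \<lbrakk>r \<in> carrier K; a \<in> carrier A\<rbrakk> \<Longrightarrow> \<phi> (r \<odot> a) = r \<odot> \<phi> a"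
  shows "\<lbrakk>x \<in> series; y \<in> series\<rbrakk> \<Longrightarrow> trunc_linear_ext N \<phi> (x \<oplus>\<^bsub>trunc_module A N\<^esub> y)
      = trunc_linear_ext N \<phi> x \<oplus>\<^bsub>trunc_module A N\<^esub> trunc_linear_ext N \<phi> y"
    and "\<lbrakk>r \<in> {..N} \<rightarrow>\<^sub>E carrier K; x \<in> series\<rbrakk> \<Longrightarrow> trunc_linear_ext N \<phi> (r \<odot>\<^bsub>trunc_module A N\<^esub> x)
      = r \<odot>\<^bsub>trunc_module A N\<^esub> trunc_linear_ext N \<phi> x"
proof -
  show "trunc_linear_ext N \<phi> (x \<oplus>\<^bsub>trunc_module A N\<^esub> y)
      = trunc_linear_ext N \<phi> x \<oplus>\<^bsub>trunc_module A N\<^esub> trunc_linear_ext N \<phi> y"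
    if "x \<in> series" "y \<in> series"
    using that[THEN PiE_atMost_mem]
    by (auto simp: trunc_linear_ext_def trunc_module_simps add intro!: restrict_ext)
  show "trunc_linear_ext N \<phi> (r \<odot>\<^bsub>trunc_module A N\<^esub> x)
      = r \<odot>\<^bsub>trunc_module A N\<^esub> trunc_linear_ext N \<phi> x"
    if "r \<in> {..N} \<rightarrow>\<^sub>E carrier K" "x \<in> series"
    unfolding trunc_linear_ext_def trunc_module_simps
  proof (rule restrict_ext)
    note mem = that[THEN PiE_atMost_mem]
    fix k assume k: "k \<in> {..N}"
    have "\<phi> (\<Oplus>i\<in>{..k}. r i \<odot> x (k - i)) = (\<Oplus>i\<in>{..k}. \<phi> (r i \<odot> x (k - i)))"
      by (rule additive) (use closed add k in \<open>auto simp: mem\<close>)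
    also have "\<dots> = (\<Oplus>i\<in>{..k}. r i \<odot> (\<lambda>k\<in>{..N}. \<phi> (x k)) (k - i))"
      by (rule M.finsum_cong') (use k in \<open>auto simp: mem smult closed\<close>)
    finally show "\<phi> ((\<lambda>k\<in>{..N}. \<Oplus>i\<in>{..k}. r i \<odot> x (k - i)) k)
      = (\<Oplus>i\<in>{..k}. r i \<odot> (\<lambda>k\<in>{..N}. \<phi> (x k)) (k - i))"
      using k by simp
  qed
qed

lemma trunc_bihom_associative_iff:
  "bihom_associative_algebra (trunc_ring K N) (trunc_module A N) ext
      (trunc_linear_ext N \<alpha>) (trunc_linear_ext N \<beta>)
    \<longleftrightarrow> (\<forall>s\<le>N. \<forall>a\<in>carrier A. \<forall>b\<in>carrier A. \<forall>c\<in>carrier A.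
      left_coeff A \<beta> m s a b c = right_coeff A \<alpha> m s a b c)" (is "?B \<longleftrightarrow> _")
proof -
  have carriers: "carrier (trunc_module A N) = series" "carrier (trunc_ring K N) = {..N} \<rightarrow>\<^sub>E carrier K"
    by (simp_all add: trunc_module_simps trunc_ring_simps)
  have "?B \<longleftrightarrow> (\<forall>x\<in>series. \<forall>y\<in>series. \<forall>z\<in>series.
      ext (trunc_linear_ext N \<alpha> x) (ext y z) = ext (ext x y) (trunc_linear_ext N \<beta> z))"
  proof
    assume ?B
    then interpret B: bihom_associative_algebra "trunc_ring K N" "trunc_module A N" ext
      "trunc_linear_ext N \<alpha>" "trunc_linear_ext N \<beta>" .
    show "\<forall>x\<in>series. \<forall>y\<in>series. \<forall>z\<in>series.
      ext (trunc_linear_ext N \<alpha> x) (ext y z) = ext (ext x y) (trunc_linear_ext N \<beta> z)"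
      using B.bihom_assoc unfolding carriers by blast
  next
    assume assoc: "\<forall>x\<in>series. \<forall>y\<in>series. \<forall>z\<in>series.
      ext (trunc_linear_ext N \<alpha> x) (ext y z) = ext (ext x y) (trunc_linear_ext N \<beta> z)"
    have "trunc_linear_ext N \<alpha> (trunc_linear_ext N \<beta> x)
      = trunc_linear_ext N \<beta> (trunc_linear_ext N \<alpha> x)" if "x \<in> series" for x
      using that[THEN PiE_atMost_mem]
      by (auto simp: trunc_linear_ext_def alpha_beta_commute intro!: restrict_ext)
    then show ?B
      unfolding bihom_associative_algebra_def bihom_associative_algebra_axioms_def carriers
      using assoc
      by (simp add: trunc_module_module ext_closed ext_add_left ext_add_right ext_smult_left
          ext_smult_right linear_ext_closed alpha_closed beta_closed linear_ext_linear
          alpha_add beta_add alpha_smult beta_smult linear_ext_ext alpha_m beta_m)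
  qed
  then show ?thesis
    unfolding ext_assoc_iff .
qed

end

section \<open>The obstruction cocycle\<close>

context product_family
begin

lemma m_left_coeff:
  assumes "i \<le> N" "s \<le> N" "a \<in> carrier A" "b \<in> carrier A" "c \<in> carrier A" "x \<in> carrier A"
  shows "m i [x, left_coeff A \<beta> m s a b c] = (\<Oplus>j\<in>{..s}. m i [x, m j [m (s - j) [a, b], \<beta> c]])"
    and "m i [left_coeff A \<beta> m s a b c, x] = (\<Oplus>j\<in>{..s}. m i [m j [m (s - j) [a, b], \<beta> c], x])"
  unfolding left_coeff_def
  by (rule m_finsum_right m_finsum_left; use assms in \<open>auto simp: m_closed beta_closed\<close>)+

lemma m_right_coeff:
  assumes "i \<le> N" "s \<le> N" "a \<in> carrier A" "b \<in> carrier A" "c \<in> carrier A" "x \<in> carrier A"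
  shows "m i [x, right_coeff A \<alpha> m s a b c] = (\<Oplus>j\<in>{..s}. m i [x, m j [\<alpha> a, m (s - j) [b, c]]])"
    and "m i [right_coeff A \<alpha> m s a b c, x] = (\<Oplus>j\<in>{..s}. m i [m j [\<alpha> a, m (s - j) [b, c]], x])"
  unfolding right_coeff_def
  by (rule m_finsum_right m_finsum_left; use assms in \<open>auto simp: m_closed alpha_closed\<close>)+

text \<open>
  For any multiplicative bilinear product, the associator
  \<open>E(a, b, c) = (ab)(\<beta> c) - (\<alpha> a)(bc)\<close> satisfies, without any associativity,

  \<open>(\<alpha>\<^sup>2 a) E(b, c, d) - E(ab, \<beta> c, \<beta> d) + E(\<alpha> a, bc, \<beta> d) - E(\<alpha> a, \<alpha> b, cd) + E(a, b, c) (\<beta>\<^sup>2 d) = 0\<close>.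

  Indeed the five terms are differences of neighbouring vertices of the pentagon formed by the five
  bracketings of \<open>a\<close>, \<open>b\<close>, \<open>c\<close>, \<open>d\<close>; multiplicativity of \<open>\<alpha>\<close> and \<open>\<beta>\<close> identifies the two expressions for
  \<open>(ab)(cd)\<close>.  The lemma is the coefficient of \<open>t\<^sup>N\<close> of this identity for \<open>\<mu>\<^sub>t\<close>: if the associator
  vanishes in all degrees below \<open>N\<close>, each term is left with the coefficient of degree \<open>N\<close> of the
  associator, and degree \<open>0\<close> remains for the other product in it.
\<close>

lemma bihom_pentagon:
  assumes lower: "\<And>s a b c. \<lbrakk>s < N; a \<in> carrier A; b \<in> carrier A; c \<in> carrier A\<rbrakk>
      \<Longrightarrow> left_coeff A \<beta> m s a b c = right_coeff A \<alpha> m s a b c"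
    and abcd: "a \<in> carrier A" "b \<in> carrier A" "c \<in> carrier A" "d \<in> carrier A"
  defines "E \<equiv> \<lambda>a b c. left_coeff A \<beta> m N a b c \<ominus> right_coeff A \<alpha> m N a b c"
  shows "m 0 [\<alpha> (\<alpha> a), E b c d] \<ominus> E (m 0 [a, b]) (\<beta> c) (\<beta> d) \<oplus> E (\<alpha> a) (m 0 [b, c]) (\<beta> d)
    \<ominus> E (\<alpha> a) (\<alpha> b) (m 0 [c, d]) \<oplus> m 0 [E a b c, \<beta> (\<beta> d)] = \<zero>"
proof -
  note closed = abcd alpha_closed beta_closed m_closed left_coeff_closed right_coeff_closed
  define S where "S = (\<lambda>T :: nat \<Rightarrow> nat \<Rightarrow> nat \<Rightarrow> 'c. \<Oplus>i\<in>{..N}. \<Oplus>j\<in>{..N - i}. T i j (N - i - j))"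
  have S_closed: "S T \<in> carrier A" if "\<And>i j l. i + j + l = N \<Longrightarrow> T i j l \<in> carrier A" for T
    unfolding S_def using that by (auto intro!: M.finsum_closed)
  \<comment> \<open>The degree \<open>N\<close> parts of the five bracketings.\<close>
  define P where "P = S (\<lambda>i j l. m i [\<alpha> (\<alpha> a), m j [\<alpha> b, m l [c, d]]])"
  define Q where "Q = S (\<lambda>i j l. m i [\<alpha> (\<alpha> a), m j [m l [b, c], \<beta> d]])"
  define U where "U = S (\<lambda>i j l. m i [m j [\<alpha> a, \<alpha> b], m l [\<beta> c, \<beta> d]])"
  define V where "V = S (\<lambda>i j l. m i [m j [m l [a, b], \<beta> c], \<beta> (\<beta> d)])"
  define W where "W = S (\<lambda>i j l. m i [m j [\<alpha> a, m l [b, c]], \<beta> (\<beta> d)])"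
  have PQUVW: "P \<in> carrier A" "Q \<in> carrier A" "U \<in> carrier A" "V \<in> carrier A" "W \<in> carrier A"
    unfolding P_def Q_def U_def V_def W_def by (auto intro!: S_closed simp: closed)
  have "(\<Oplus>i\<in>{..N}. m i [\<alpha> (\<alpha> a), left_coeff A \<beta> m (N - i) b c d]) = Q"
    unfolding Q_def S_def
    by (rule M.finsum_cong') (auto simp: closed m_left_coeff intro!: M.finsum_closed)
  moreover have "(\<Oplus>i\<in>{..N}. m i [\<alpha> (\<alpha> a), right_coeff A \<alpha> m (N - i) b c d]) = P"
    unfolding P_def S_def
    by (rule M.finsum_cong') (auto simp: closed m_right_coeff intro!: M.finsum_closed)
  moreover have "(\<Oplus>i\<in>{..N}. m i [\<alpha> (\<alpha> a), left_coeff A \<beta> m (N - i) b c d])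
      \<ominus> (\<Oplus>i\<in>{..N}. m i [\<alpha> (\<alpha> a), right_coeff A \<alpha> m (N - i) b c d])
    = m 0 [\<alpha> (\<alpha> a), left_coeff A \<beta> m N b c d] \<ominus> m 0 [\<alpha> (\<alpha> a), right_coeff A \<alpha> m N b c d]"
    by (subst M.finsum_minus_only_0) (auto simp: closed lower)
  ultimately have 1: "m 0 [\<alpha> (\<alpha> a), E b c d] = Q \<ominus> P"
    by (simp add: E_def closed m_minus_right)

  have "(\<Oplus>i\<in>{..N}. left_coeff A \<beta> m (N - i) (m i [a, b]) (\<beta> c) (\<beta> d)) = V"
    unfolding V_def S_def left_coeff_def
    by (rule M.finsum_triples_rotate) (auto simp: closed)
  moreover have "(\<Oplus>i\<in>{..N}. right_coeff A \<alpha> m (N - i) (m i [a, b]) (\<beta> c) (\<beta> d)) = U"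
  proof -
    have "(\<Oplus>i\<in>{..N}. right_coeff A \<alpha> m (N - i) (m i [a, b]) (\<beta> c) (\<beta> d))
      = (\<Oplus>i\<in>{..N}. \<Oplus>j\<in>{..N - i}. m j [m i [\<alpha> a, \<alpha> b], m (N - i - j) [\<beta> c, \<beta> d]])"
      unfolding right_coeff_def
      by (intro M.finsum_cong') (auto simp: closed alpha_m intro!: M.finsum_closed)
    also have "\<dots> = U"
      unfolding U_def S_def
      by (rule M.finsum_triples_transpose) (auto simp: closed)
    finally show ?thesis .
  qed
  moreover have "(\<Oplus>i\<in>{..N}. left_coeff A \<beta> m (N - i) (m i [a, b]) (\<beta> c) (\<beta> d))
      \<ominus> (\<Oplus>i\<in>{..N}. right_coeff A \<alpha> m (N - i) (m i [a, b]) (\<beta> c) (\<beta> d))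
    = E (m 0 [a, b]) (\<beta> c) (\<beta> d)"
    unfolding E_def by (subst M.finsum_minus_only_0) (auto simp: closed lower)
  ultimately have 2: "E (m 0 [a, b]) (\<beta> c) (\<beta> d) = V \<ominus> U"
    by simp

  have "(\<Oplus>i\<in>{..N}. left_coeff A \<beta> m (N - i) (\<alpha> a) (m i [b, c]) (\<beta> d)) = W"
    unfolding W_def S_def left_coeff_def
    by (rule M.finsum_triples_rotate) (auto simp: closed)
  moreover have "(\<Oplus>i\<in>{..N}. right_coeff A \<alpha> m (N - i) (\<alpha> a) (m i [b, c]) (\<beta> d)) = Q"
    unfolding Q_def S_def right_coeff_def
    by (rule M.finsum_triples_rotate) (auto simp: closed)
  moreover have "(\<Oplus>i\<in>{..N}. left_coeff A \<beta> m (N - i) (\<alpha> a) (m i [b, c]) (\<beta> d))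
      \<ominus> (\<Oplus>i\<in>{..N}. right_coeff A \<alpha> m (N - i) (\<alpha> a) (m i [b, c]) (\<beta> d))
    = E (\<alpha> a) (m 0 [b, c]) (\<beta> d)"
    unfolding E_def by (subst M.finsum_minus_only_0) (auto simp: closed lower)
  ultimately have 3: "E (\<alpha> a) (m 0 [b, c]) (\<beta> d) = W \<ominus> Q"
    by simp

  have "(\<Oplus>i\<in>{..N}. left_coeff A \<beta> m (N - i) (\<alpha> a) (\<alpha> b) (m i [c, d])) = U"
  proof -
    have "(\<Oplus>i\<in>{..N}. left_coeff A \<beta> m (N - i) (\<alpha> a) (\<alpha> b) (m i [c, d]))
      = (\<Oplus>i\<in>{..N}. \<Oplus>j\<in>{..N - i}. m j [m (N - i - j) [\<alpha> a, \<alpha> b], m i [\<beta> c, \<beta> d]])"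
      unfolding left_coeff_def
      by (intro M.finsum_cong') (auto simp: closed beta_m intro!: M.finsum_closed)
    also have "\<dots> = U"
      unfolding U_def S_def
      by (rule M.finsum_triples_rotate) (auto simp: closed)
    finally show ?thesis .
  qed
  moreover have "(\<Oplus>i\<in>{..N}. right_coeff A \<alpha> m (N - i) (\<alpha> a) (\<alpha> b) (m i [c, d])) = P"
    unfolding P_def S_def right_coeff_def
    by (rule M.finsum_triples_rotate) (auto simp: closed)
  moreover have "(\<Oplus>i\<in>{..N}. left_coeff A \<beta> m (N - i) (\<alpha> a) (\<alpha> b) (m i [c, d]))
      \<ominus> (\<Oplus>i\<in>{..N}. right_coeff A \<alpha> m (N - i) (\<alpha> a) (\<alpha> b) (m i [c, d]))
    = E (\<alpha> a) (\<alpha> b) (m 0 [c, d])"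
    unfolding E_def by (subst M.finsum_minus_only_0) (auto simp: closed lower)
  ultimately have 4: "E (\<alpha> a) (\<alpha> b) (m 0 [c, d]) = U \<ominus> P"
    by simp

  have "(\<Oplus>i\<in>{..N}. m i [left_coeff A \<beta> m (N - i) a b c, \<beta> (\<beta> d)]) = V"
    unfolding V_def S_def
    by (rule M.finsum_cong') (auto simp: closed m_left_coeff intro!: M.finsum_closed)
  moreover have "(\<Oplus>i\<in>{..N}. m i [right_coeff A \<alpha> m (N - i) a b c, \<beta> (\<beta> d)]) = W"
    unfolding W_def S_def
    by (rule M.finsum_cong') (auto simp: closed m_right_coeff intro!: M.finsum_closed)
  moreover have "(\<Oplus>i\<in>{..N}. m i [left_coeff A \<beta> m (N - i) a b c, \<beta> (\<beta> d)])
      \<ominus> (\<Oplus>i\<in>{..N}. m i [right_coeff A \<alpha> m (N - i) a b c, \<beta> (\<beta> d)])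
    = m 0 [left_coeff A \<beta> m N a b c, \<beta> (\<beta> d)] \<ominus> m 0 [right_coeff A \<alpha> m N a b c, \<beta> (\<beta> d)]"
    by (subst M.finsum_minus_only_0) (auto simp: closed lower)
  ultimately have 5: "m 0 [E a b c, \<beta> (\<beta> d)] = V \<ominus> W"
    by (simp add: E_def closed m_minus_left)

  have "Q \<ominus> P \<ominus> (V \<ominus> U) \<oplus> (W \<ominus> Q) \<ominus> (U \<ominus> P) \<oplus> (V \<ominus> W)
    = (Q \<oplus> \<ominus> Q) \<oplus> (P \<oplus> \<ominus> P) \<oplus> (V \<oplus> \<ominus> V) \<oplus> (U \<oplus> \<ominus> U) \<oplus> (W \<oplus> \<ominus> W)"
    using PQUVW by (simp add: a_minus_def M.minus_add M.a_ac del: M.r_neg)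
  also have "\<dots> = \<zero>"
    using PQUVW by (simp add: M.r_neg)
  finally show ?thesis
    unfolding 1 2 3 4 5 .
qed

end

lemma (in bihom_associative_algebra) is_bihom_module: "bihom_module R A \<alpha> \<beta>"
  by unfold_locales (simp_all add: alpha_closed alpha_add alpha_smult beta_closed beta_add
      beta_smult alpha_beta_commute)

context bihom_module
begin

lemma sign_smult:
  fixes i :: nat
  assumes "x \<in> carrier A"
  shows "((\<ominus>\<^bsub>K\<^esub> \<one>\<^bsub>K\<^esub>) [^]\<^bsub>K\<^esub> i) \<odot> x = (if even i then x else \<ominus> x)"
proof (induction i)
  case (Suc i)
  then show ?case
    using assms by (simp add: smult_assoc1 smult_l_minus smult_r_minus)
qed (use assms in simp)

lemma coboundary_2:
  assumes f: "f \<in> hoch_cochains K A \<alpha> \<beta> 2"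
    and mu: "\<And>a b. \<lbrakk>a \<in> carrier A; b \<in> carrier A\<rbrakk> \<Longrightarrow> \<mu> a b \<in> carrier A"
    and abc: "a \<in> carrier A" "b \<in> carrier A" "c \<in> carrier A"
  shows "hoch_coboundary K A \<mu> \<alpha> \<beta> 2 f [a, b, c]
    = \<mu> (\<alpha> a) (f [b, c]) \<oplus> f [\<alpha> a, \<mu> b c] \<ominus> (f [\<mu> a b, \<beta> c] \<oplus> \<mu> (f [a, b]) (\<beta> c))"
proof -
  have t: "[a, b, c] \<in> tuples A 3"
    using abc by (simp add: tuples_def)
  have int: "{1..2::nat} = {1, 2}"
    by auto
  note closed = abc mu cochain2(1)[OF f] alpha_closed beta_closed
  show ?thesis
    unfolding hoch_coboundary_def int
    using t by (simp add: sign_smult smult_l_minus closed a_minus_def M.minus_add M.a_ac)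
qed

lemma coboundary_3:
  assumes f: "f \<in> hoch_cochains K A \<alpha> \<beta> 3"
    and mu: "\<And>a b. \<lbrakk>a \<in> carrier A; b \<in> carrier A\<rbrakk> \<Longrightarrow> \<mu> a b \<in> carrier A"
    and abcd: "a \<in> carrier A" "b \<in> carrier A" "c \<in> carrier A" "d \<in> carrier A"
  shows "hoch_coboundary K A \<mu> \<alpha> \<beta> 3 f [a, b, c, d]
    = \<mu> (\<alpha> (\<alpha> a)) (f [b, c, d]) \<ominus> f [\<mu> a b, \<beta> c, \<beta> d] \<oplus> f [\<alpha> a, \<mu> b c, \<beta> d]
      \<ominus> f [\<alpha> a, \<alpha> b, \<mu> c d] \<oplus> \<mu> (f [a, b, c]) (\<beta> (\<beta> d))"
proof -
  have t: "[a, b, c, d] \<in> tuples A 4"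
    using abcd by (simp add: tuples_def)
  have int: "{1..3::nat} = {1, 2, 3}"
    by auto
  have f_closed: "f [x, y, z] \<in> carrier A"
    if "x \<in> carrier A" "y \<in> carrier A" "z \<in> carrier A" for x y z
    using hoch_cochainsD(1)[OF f] that by (simp add: tuples_def)
  have funpow_2: "(\<phi> ^^ 2) x = \<phi> (\<phi> x)" for \<phi> :: "'c \<Rightarrow> 'c" and x
    by (simp add: numeral_2_eq_2)
  note closed = abcd mu f_closed alpha_closed beta_closed
  show ?thesis
    unfolding hoch_coboundary_def int
    using t by (simp add: funpow_2 sign_smult smult_l_minus closed a_minus_def M.minus_add M.a_ac)
qed

end

lemma tuples_3E:
  assumes "xs \<in> tuples A 3"
  obtains a b c where "xs = [a, b, c]" "a \<in> carrier A" "b \<in> carrier A" "c \<in> carrier A"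
  using assms that by (auto simp: tuples_def length_Suc_conv numeral_eq_Suc)

lemma tuples_4E:
  assumes "xs \<in> tuples A 4"
  obtains a b c d where "xs = [a, b, c, d]"
    "a \<in> carrier A" "b \<in> carrier A" "c \<in> carrier A" "d \<in> carrier A"
  using assms that by (auto simp: tuples_def length_Suc_conv numeral_eq_Suc)

lemma hoch_coboundary_eqI:
  assumes "\<And>xs. xs \<in> tuples A (Suc n) \<Longrightarrow> hoch_coboundary K A \<mu> \<alpha> \<beta> n f xs = g xs"
  shows "hoch_coboundary K A \<mu> \<alpha> \<beta> n f = (\<lambda>xs\<in>tuples A (Suc n). g xs)"
proof (rule extensionalityI[where A = "tuples A (Suc n)"])
  show "hoch_coboundary K A \<mu> \<alpha> \<beta> n f \<in> extensional (tuples A (Suc n))"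
    by (simp add: hoch_coboundary_def)
qed (simp_all add: assms)

lemma (in abelian_group) minus_eq_minus_imp:
  assumes "x \<ominus> y = z \<ominus> w" "x \<in> carrier G" "y \<in> carrier G" "z \<in> carrier G" "w \<in> carrier G"
  shows "x \<oplus> w = y \<oplus> z"
proof -
  have "x \<oplus> w = (x \<ominus> y) \<oplus> (y \<oplus> w)"
    using assms(2-5) by (simp add: a_minus_def a_assoc r_neg1)
  also have "\<dots> = (z \<ominus> w) \<oplus> (w \<oplus> y)"
    using assms(2-5) by (simp add: assms(1) a_comm[of y w])
  also have "\<dots> = z \<oplus> y"
    using assms(2-5) by (simp add: a_minus_def a_assoc r_neg1)
  finally show ?thesis
    using assms(2-5) by (simp add: a_comm)
qed

context product_family
begin

lemma left_product_cochain:
  assumes "i \<le> N" "j \<le> N"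
  defines "f \<equiv> (\<lambda>xs\<in>tuples A 3. m i [m j [xs ! 0, xs ! 1], \<beta> (xs ! 2)])"
  shows "f \<in> hoch_cochains K A \<alpha> \<beta> 3"
proof (rule hoch_cochainsI)
  have f_eq: "f [a, b, c] = m i [m j [a, b], \<beta> c]"
    if "a \<in> carrier A" "b \<in> carrier A" "c \<in> carrier A" for a b c
    using that by (simp add: f_def tuples_def)
  note simps = f_eq alpha_closed beta_closed m_closed assms(1,2)
  show "f \<in> tuples A 3 \<rightarrow>\<^sub>E carrier A"
    using assms(1,2) by (auto simp: m_closed beta_closed f_def elim!: tuples_3E)
  fix xs assume "xs \<in> tuples A 3"
  then obtain a b c where xs: "xs = [a, b, c]" "a \<in> carrier A" "b \<in> carrier A" "c \<in> carrier A"
    by (rule tuples_3E)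
  show "\<alpha> (f xs) = f (map \<alpha> xs)"
    using xs by (simp add: simps alpha_m alpha_beta_commute)
  show "\<beta> (f xs) = f (map \<beta> xs)"
    using xs by (simp add: simps beta_m)
  fix k x y assume "k < (3::nat)" and x: "x \<in> carrier A"
  then have k: "k = 0 \<or> k = 1 \<or> k = 2"
    by auto
  show "f (xs[k := r \<odot> x]) = r \<odot> f (xs[k := x])" if "r \<in> carrier K" for r
    using k xs x that
    by (elim disjE) (simp_all add: simps m_smult_left m_smult_right beta_smult)
  assume "y \<in> carrier A"
  then show "f (xs[k := x \<oplus> y]) = f (xs[k := x]) \<oplus> f (xs[k := y])"
    using k xs x
    by (elim disjE) (simp_all add: simps m_add_left m_add_right beta_add)
qed

lemma right_product_cochain:
  assumes "i \<le> N" "j \<le> N"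
  defines "f \<equiv> (\<lambda>xs\<in>tuples A 3. m i [\<alpha> (xs ! 0), m j [xs ! 1, xs ! 2]])"
  shows "f \<in> hoch_cochains K A \<alpha> \<beta> 3"
proof (rule hoch_cochainsI)
  have f_eq: "f [a, b, c] = m i [\<alpha> a, m j [b, c]]"
    if "a \<in> carrier A" "b \<in> carrier A" "c \<in> carrier A" for a b c
    using that by (simp add: f_def tuples_def)
  note simps = f_eq alpha_closed beta_closed m_closed assms(1,2)
  show "f \<in> tuples A 3 \<rightarrow>\<^sub>E carrier A"
    using assms(1,2) by (auto simp: m_closed alpha_closed f_def elim!: tuples_3E)
  fix xs assume "xs \<in> tuples A 3"
  then obtain a b c where xs: "xs = [a, b, c]" "a \<in> carrier A" "b \<in> carrier A" "c \<in> carrier A"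
    by (rule tuples_3E)
  show "\<alpha> (f xs) = f (map \<alpha> xs)"
    using xs by (simp add: simps alpha_m)
  show "\<beta> (f xs) = f (map \<beta> xs)"
    using xs by (simp add: simps beta_m alpha_beta_commute)
  fix k x y assume "k < (3::nat)" and x: "x \<in> carrier A"
  then have k: "k = 0 \<or> k = 1 \<or> k = 2"
    by auto
  show "f (xs[k := r \<odot> x]) = r \<odot> f (xs[k := x])" if "r \<in> carrier K" for r
    using k xs x that
    by (elim disjE) (simp_all add: simps m_smult_left m_smult_right alpha_smult)
  assume "y \<in> carrier A"
  then show "f (xs[k := x \<oplus> y]) = f (xs[k := x]) \<oplus> f (xs[k := y])"
    using k xs x
    by (elim disjE) (simp_all add: simps m_add_left m_add_right alpha_add)
qed

text \<open>
  Once the lower coefficients of the associator vanish, the coefficient of degree \<open>N\<close> is the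
  obstruction cocycle.
\<close>

definition associator :: "'c list \<Rightarrow> 'c" where
  "associator = (\<lambda>xs\<in>tuples A 3.
    left_coeff A \<beta> m N (xs ! 0) (xs ! 1) (xs ! 2) \<ominus> right_coeff A \<alpha> m N (xs ! 0) (xs ! 1) (xs ! 2))"

lemma associator_apply:
  "\<lbrakk>a \<in> carrier A; b \<in> carrier A; c \<in> carrier A\<rbrakk>
    \<Longrightarrow> associator [a, b, c] = left_coeff A \<beta> m N a b c \<ominus> right_coeff A \<alpha> m N a b c"
  by (simp add: associator_def tuples_def)

lemma associator_cochain: "associator \<in> hoch_cochains K A \<alpha> \<beta> 3"
proof -
  have "(\<lambda>xs\<in>tuples A 3. \<Oplus>i\<in>{..N}. (\<lambda>xs\<in>tuples A 3. m i [m (N - i) [xs ! 0, xs ! 1], \<beta> (xs ! 2)]) xs)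
      \<in> hoch_cochains K A \<alpha> \<beta> 3"
    and "(\<lambda>xs\<in>tuples A 3. \<Oplus>i\<in>{..N}. (\<lambda>xs\<in>tuples A 3. m i [\<alpha> (xs ! 0), m (N - i) [xs ! 1, xs ! 2]]) xs)
      \<in> hoch_cochains K A \<alpha> \<beta> 3"
    by (rule cochain_finsum, rule left_product_cochain right_product_cochain; simp)+
  from cochain_minus[OF this] show ?thesis
    by (simp add: associator_def left_coeff_def right_coeff_def cong: restrict_cong)
qed

lemma associator_cocycle:
  assumes lower: "\<And>s a b c. \<lbrakk>s < N; a \<in> carrier A; b \<in> carrier A; c \<in> carrier A\<rbrakk>
      \<Longrightarrow> left_coeff A \<beta> m s a b c = right_coeff A \<alpha> m s a b c"
    and mu: "\<And>a b. \<lbrakk>a \<in> carrier A; b \<in> carrier A\<rbrakk> \<Longrightarrow> m 0 [a, b] = \<mu> a b"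
  shows "associator \<in> hoch_cocycles K A \<mu> \<alpha> \<beta> 3"
proof -
  have mu_closed: "\<mu> a b \<in> carrier A" if "a \<in> carrier A" "b \<in> carrier A" for a b
    using m_closed[of 0 a b] that by (simp add: mu)
  have "hoch_coboundary K A \<mu> \<alpha> \<beta> 3 associator xs = \<zero>" if xs4: "xs \<in> tuples A 4" for xs
  proof -
    obtain a b c d where xs: "xs = [a, b, c, d]"
      and abcd: "a \<in> carrier A" "b \<in> carrier A" "c \<in> carrier A" "d \<in> carrier A"
      using xs4 by (rule tuples_4E)
    have "hoch_coboundary K A \<mu> \<alpha> \<beta> 3 associator [a, b, c, d] = \<zero>"
      using bihom_pentagon[OF lower abcd] abcd
      by (simp add: coboundary_3[OF associator_cochain] mu_closed associator_apply mu
          alpha_closed beta_closed left_coeff_closed right_coeff_closed)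
    then show ?thesis
      by (simp add: xs)
  qed
  then have "hoch_coboundary K A \<mu> \<alpha> \<beta> 3 associator = (\<lambda>xs\<in>tuples A 4. \<zero>)"
    using hoch_coboundary_eqI[of A 3 K \<mu> \<alpha> \<beta> associator "\<lambda>_. \<zero>"] by simp
  then show ?thesis
    by (simp add: hoch_cocycles_def kernel_def hoch_cochain_group_def associator_cochain)
qed

lemma coeff_cong:
  assumes "s \<le> N" "\<And>i. i \<le> s \<Longrightarrow> m' i = m i" "a \<in> carrier A" "b \<in> carrier A" "c \<in> carrier A"
  shows "left_coeff A \<beta> m' s a b c = left_coeff A \<beta> m s a b c"
    and "right_coeff A \<alpha> m' s a b c = right_coeff A \<alpha> m s a b c"
  unfolding left_coeff_def right_coeff_def
  by (rule M.finsum_cong'; use assms in \<open>auto simp: m_closed alpha_closed beta_closed\<close>)+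

lemma finsum_split_ends:
  fixes n :: nat
  assumes "\<And>i. i \<le> Suc n \<Longrightarrow> f i \<in> carrier A"
  shows "finsum A f {..Suc n} = (\<Oplus>i\<in>{..<n}. f (Suc i)) \<oplus> (f (Suc n) \<oplus> f 0)"
proof -
  have "finsum A f {..Suc n} = (\<Oplus>i\<in>{..n}. f (Suc i)) \<oplus> f 0"
    by (rule M.finsum_Suc2) (use assms in auto)
  also have "(\<Oplus>i\<in>{..n}. f (Suc i)) = f (Suc n) \<oplus> (\<Oplus>i\<in>{..<n}. f (Suc i))"
    by (rule M.add.finprod_Suc3) (use assms in auto)
  finally show ?thesis
    using assms by (simp add: M.a_ac)
qed

end

context bihom_module
begin

text \<open>
  In degree \<open>n + 1\<close> the coefficient \<open>m\<^sub>n\<^sub>+\<^sub>1\<close> occurs only next to \<open>m\<^sub>0\<close>, so it enters linearly.  By the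
  formula for \<open>\<delta>\<close> in degree \<open>2\<close> with respect to \<open>m\<^sub>0\<close>, replacing \<open>m\<^sub>n\<^sub>+\<^sub>1 = 0\<close> by \<open>f\<close> subtracts \<open>\<delta> f\<close> from the coefficient of
  the associator.
\<close>

lemma coeff_update_top:
  assumes fam: "\<And>i. i \<le> n \<Longrightarrow> m i \<in> hoch_cochains K A \<alpha> \<beta> 2"
    and f: "f \<in> hoch_cochains K A \<alpha> \<beta> 2"
    and abc: "a \<in> carrier A" "b \<in> carrier A" "c \<in> carrier A"
  defines "z \<equiv> (\<lambda>xs\<in>tuples A 2. \<zero>)"
  shows "left_coeff A \<beta> (m(Suc n := f)) (Suc n) a b c
      = left_coeff A \<beta> (m(Suc n := z)) (Suc n) a b c \<oplus> (f [m 0 [a, b], \<beta> c] \<oplus> m 0 [f [a, b], \<beta> c])"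
    and "right_coeff A \<alpha> (m(Suc n := f)) (Suc n) a b c
      = right_coeff A \<alpha> (m(Suc n := z)) (Suc n) a b c \<oplus> (f [\<alpha> a, m 0 [b, c]] \<oplus> m 0 [\<alpha> a, f [b, c]])"
proof -
  have family: "product_family K A \<alpha> \<beta> (Suc n) (m(Suc n := g))"
    if "g \<in> hoch_cochains K A \<alpha> \<beta> 2" for g
    by unfold_locales (use fam that in \<open>auto simp: le_Suc_eq\<close>)
  define L where "L = (\<Oplus>i\<in>{..<n}. m (Suc i) [m (n - i) [a, b], \<beta> c])"
  define R where "R = (\<Oplus>i\<in>{..<n}. m (Suc i) [\<alpha> a, m (n - i) [b, c]])"
  have m_closed: "m i [x, y] \<in> carrier A" if "i \<le> n" "x \<in> carrier A" "y \<in> carrier A" for i x y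
    using fam[THEN cochain2(1)] that by blast
  have LR: "L \<in> carrier A" "R \<in> carrier A"
    unfolding L_def R_def
    by (auto intro!: M.finsum_closed m_closed simp: abc alpha_closed beta_closed)
  have split: "left_coeff A \<beta> (m(Suc n := g)) (Suc n) a b c
      = L \<oplus> (g [m 0 [a, b], \<beta> c] \<oplus> m 0 [g [a, b], \<beta> c])"
    "right_coeff A \<alpha> (m(Suc n := g)) (Suc n) a b c
      = R \<oplus> (g [\<alpha> a, m 0 [b, c]] \<oplus> m 0 [\<alpha> a, g [b, c]])"
    if g: "g \<in> hoch_cochains K A \<alpha> \<beta> 2" for g
  proof -
    interpret G: product_family K A \<alpha> \<beta> "Suc n" "m(Suc n := g)"
      by (rule family[OF g])
    have "(\<Oplus>i\<in>{..<n}. (m(Suc n := g)) (Suc i) [(m(Suc n := g)) (Suc n - Suc i) [a, b], \<beta> c]) = L"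
      unfolding L_def by (rule M.finsum_cong') (auto simp: m_closed abc beta_closed)
    then show "left_coeff A \<beta> (m(Suc n := g)) (Suc n) a b c
      = L \<oplus> (g [m 0 [a, b], \<beta> c] \<oplus> m 0 [g [a, b], \<beta> c])"
      unfolding left_coeff_def
      by (subst G.finsum_split_ends) (auto intro!: G.m_closed simp: abc beta_closed simp del: fun_upd_apply, simp)
    have "(\<Oplus>i\<in>{..<n}. (m(Suc n := g)) (Suc i) [\<alpha> a, (m(Suc n := g)) (Suc n - Suc i) [b, c]]) = R"
      unfolding R_def by (rule M.finsum_cong') (auto simp: m_closed abc alpha_closed)
    then show "right_coeff A \<alpha> (m(Suc n := g)) (Suc n) a b c
      = R \<oplus> (g [\<alpha> a, m 0 [b, c]] \<oplus> m 0 [\<alpha> a, g [b, c]])"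
      unfolding right_coeff_def
      by (subst G.finsum_split_ends) (auto intro!: G.m_closed simp: abc alpha_closed simp del: fun_upd_apply, simp)
  qed
  have z: "z \<in> hoch_cochains K A \<alpha> \<beta> 2"
    unfolding z_def by (rule cochain_zero)
  have z_apply: "z [x, y] = \<zero>" if "x \<in> carrier A" "y \<in> carrier A" for x y
    using that by (simp add: z_def tuples_def)
  interpret F: product_family K A \<alpha> \<beta> n m
    by unfold_locales (rule fam)
  have "z [m 0 [a, b], \<beta> c] \<oplus> m 0 [z [a, b], \<beta> c] = \<zero>"
    "z [\<alpha> a, m 0 [b, c]] \<oplus> m 0 [\<alpha> a, z [b, c]] = \<zero>"
    using abc by (simp_all add: z_apply F.m_closed F.m_zero_left F.m_zero_right alpha_closed beta_closed)
  then show "left_coeff A \<beta> (m(Suc n := f)) (Suc n) a b c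
      = left_coeff A \<beta> (m(Suc n := z)) (Suc n) a b c \<oplus> (f [m 0 [a, b], \<beta> c] \<oplus> m 0 [f [a, b], \<beta> c])"
    and "right_coeff A \<alpha> (m(Suc n := f)) (Suc n) a b c
      = right_coeff A \<alpha> (m(Suc n := z)) (Suc n) a b c \<oplus> (f [\<alpha> a, m 0 [b, c]] \<oplus> m 0 [\<alpha> a, f [b, c]])"
    unfolding split[OF f] split[OF z] using LR by simp_all
qed

end

section \<open>Extending deformations\<close>

text \<open>
  By the characterisation of bihom-associativity for truncated series, the last condition in the
  definition of a deformation amounts to the classical deformation equations
  \<open>\<Sum>\<^sub>i\<^sub>+\<^sub>j\<^sub>=\<^sub>s m\<^sub>i(m\<^sub>j(a, b), \<beta> c) = \<Sum>\<^sub>i\<^sub>+\<^sub>j\<^sub>=\<^sub>s m\<^sub>i(\<alpha> a, m\<^sub>j(b, c))\<close> for \<open>s \<le> n\<close>.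
\<close>

lemma is_deformation_iff:
  assumes "bihom_associative_algebra K A \<mu> \<alpha> \<beta>"
  shows "is_deformation K A \<mu> \<alpha> \<beta> n m \<longleftrightarrow>
    (\<forall>i\<le>n. m i \<in> hoch_cochains K A \<alpha> \<beta> 2) \<and>
    (\<forall>a\<in>carrier A. \<forall>b\<in>carrier A. m 0 [a, b] = \<mu> a b) \<and>
    (\<forall>s\<le>n. \<forall>a\<in>carrier A. \<forall>b\<in>carrier A. \<forall>c\<in>carrier A.
      left_coeff A \<beta> m s a b c = right_coeff A \<alpha> m s a b c)"
proof (cases "\<forall>i\<le>n. m i \<in> hoch_cochains K A \<alpha> \<beta> 2")
  case True
  interpret B: bihom_module K A \<alpha> \<beta>
    using assms by (rule bihom_associative_algebra.is_bihom_module)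
  interpret product_family K A \<alpha> \<beta> n m
    by unfold_locales (use True in blast)
  show ?thesis
    unfolding is_deformation_def trunc_bihom_associative_iff by (rule refl)
next
  case False
  then show ?thesis
    by (auto simp: is_deformation_def)
qed

text \<open>
  In a trivial quotient the coset of \<open>f\<close> is the subgroup of coboundaries itself.  That subgroup
  contains zero, being the coboundary of zero, so the coset contains \<open>f\<close>.
\<close>

lemma trivial_cohomology_3:
  assumes "bihom_associative_algebra K A \<mu> \<alpha> \<beta>"
    and triv: "trivial_group (hoch_cohomology K A \<mu> \<alpha> \<beta> 3)"
    and f: "f \<in> hoch_cocycles K A \<mu> \<alpha> \<beta> 3"
  shows "\<exists>g\<in>hoch_cochains K A \<alpha> \<beta> 2. hoch_coboundary K A \<mu> \<alpha> \<beta> 2 g = f"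
proof -
  interpret bihom_associative_algebra K A \<mu> \<alpha> \<beta> by fact
  interpret B: bihom_module K A \<alpha> \<beta> by (rule is_bihom_module)
  define G where "G = (hoch_cochain_group K A \<alpha> \<beta> 3)\<lparr>carrier := hoch_cocycles K A \<mu> \<alpha> \<beta> 3\<rparr>"
  define H where "H = hoch_coboundary K A \<mu> \<alpha> \<beta> 2 ` hoch_cochains K A \<alpha> \<beta> 2"
  define z where "z n = (\<lambda>xs\<in>tuples A n. \<zero>\<^bsub>A\<^esub>)" for n
  have mult_G: "g \<otimes>\<^bsub>G\<^esub> h = (\<lambda>xs\<in>tuples A 3. g xs \<oplus>\<^bsub>A\<^esub> h xs)" for g h
    by (simp add: G_def hoch_cochain_group_def)
  have "z 3 \<in> H"
  proof -
    have z: "z 2 \<in> hoch_cochains K A \<alpha> \<beta> 2"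
      unfolding z_def by (rule B.cochain_zero)
    have mu_zero: "\<mu> \<zero>\<^bsub>A\<^esub> a = \<zero>\<^bsub>A\<^esub>" "\<mu> a \<zero>\<^bsub>A\<^esub> = \<zero>\<^bsub>A\<^esub>" if "a \<in> carrier A" for a
      by (rule additive_zero[OF M.abelian_group_axioms M.abelian_group_axioms, of "\<lambda>b. \<mu> b a"]
          additive_zero[OF M.abelian_group_axioms M.abelian_group_axioms, of "\<lambda>b. \<mu> a b"];
          simp add: that mu_closed mu_add_left mu_add_right)+
    have z_apply: "z 2 [a, b] = \<zero>\<^bsub>A\<^esub>" if "a \<in> carrier A" "b \<in> carrier A" for a b
      using that by (simp add: z_def tuples_def)
    have "hoch_coboundary K A \<mu> \<alpha> \<beta> 2 (z 2) xs = \<zero>\<^bsub>A\<^esub>" if xs: "xs \<in> tuples A 3" for xs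
    proof -
      obtain a b c where "xs = [a, b, c]" "a \<in> carrier A" "b \<in> carrier A" "c \<in> carrier A"
        using xs by (rule tuples_3E)
      then show ?thesis
        by (simp add: B.coboundary_2[OF z] mu_closed alpha_closed beta_closed mu_zero z_apply a_minus_def)
    qed
    then have "hoch_coboundary K A \<mu> \<alpha> \<beta> 2 (z 2) = z 3"
      using hoch_coboundary_eqI[of A 2 K \<mu> \<alpha> \<beta> "z 2" "\<lambda>_. \<zero>\<^bsub>A\<^esub>"] by (simp add: z_def)
    then show ?thesis
      unfolding H_def by (intro image_eqI[OF _ z]) simp
  qed
  moreover have "z 3 \<otimes>\<^bsub>G\<^esub> f = f"
  proof -
    have f_mem: "f \<in> tuples A 3 \<rightarrow>\<^sub>E carrier A"
      using f by (simp add: hoch_cocycles_def kernel_def hoch_cochain_group_def hoch_cochains_def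
          multilinear_maps_def)
    show ?thesis
      unfolding mult_G z_def
      by (intro PiE_ext[where k = "tuples A 3" and s = "\<lambda>_. carrier A"])
        (use f_mem PiE_mem[OF f_mem] in \<open>auto simp: PiE_mem[OF f_mem]\<close>)
  qed
  ultimately have "f \<in> H #>\<^bsub>G\<^esub> f"
    unfolding r_coset_def by (intro UN_I[where a = "z 3"]) simp_all
  moreover have "H #>\<^bsub>G\<^esub> f = H"
  proof -
    have "hoch_cohomology K A \<mu> \<alpha> \<beta> 3 = G Mod H"
      by (simp add: hoch_cohomology_def hoch_coboundaries_def G_def H_def)
    moreover have "f \<in> carrier G"
      using f by (simp add: G_def)
    ultimately show ?thesis
      using triv by (auto simp: trivial_group_def FactGroup_def RCOSETS_def)
  qed
  ultimately show ?thesis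
    by (auto simp: H_def)
qed

theorem theorem5p8:
  fixes K :: "('k, 'm) ring_scheme" and A :: "('k, 'a, 'n) module_scheme"
    and \<mu> :: "'a \<Rightarrow> 'a \<Rightarrow> 'a" and \<alpha> \<beta> :: "'a \<Rightarrow> 'a"
    and n :: nat and \<mu>s :: "nat \<Rightarrow> 'a list \<Rightarrow> 'a"
  assumes "field K"
    and char_zero: "\<And>m :: nat. m > 0 \<Longrightarrow> [m] \<cdot>\<^bsub>K\<^esub> \<one>\<^bsub>K\<^esub> \<noteq> \<zero>\<^bsub>K\<^esub>"
    and "bihom_associative_algebra K A \<mu> \<alpha> \<beta>"
    and "trivial_group (hoch_cohomology K A \<mu> \<alpha> \<beta> 3)"
    and "is_deformation K A \<mu> \<alpha> \<beta> n \<mu>s"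
  shows "\<exists>\<mu>' \<in> hoch_cochains K A \<alpha> \<beta> 2.
    is_deformation K A \<mu> \<alpha> \<beta> (n + 1) (\<mu>s(n + 1 := \<mu>'))"
proof -
  note alg = assms(3)
  interpret bihom_associative_algebra K A \<mu> \<alpha> \<beta> by (rule alg)
  interpret B: bihom_module K A \<alpha> \<beta> by (rule is_bihom_module)
  note deformation = assms(5)[unfolded is_deformation_iff[OF alg]]
  have cochain: "\<mu>s i \<in> hoch_cochains K A \<alpha> \<beta> 2" if "i \<le> n" for i
    using deformation that by simp
  have mu0: "\<mu>s 0 [a, b] = \<mu> a b" if "a \<in> carrier A" "b \<in> carrier A" for a b
    using deformation that by simp
  have assoc: "left_coeff A \<beta> \<mu>s s a b c = right_coeff A \<alpha> \<mu>s s a b c"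
    if "s \<le> n" "a \<in> carrier A" "b \<in> carrier A" "c \<in> carrier A" for s a b c
    using deformation that by simp
  interpret D: product_family K A \<alpha> \<beta> n \<mu>s
    by unfold_locales (rule cochain)
  \<comment> \<open>The extension by \<open>\<mu>\<^sub>n\<^sub>+\<^sub>1 = 0\<close>, whose associator in degree \<open>n + 1\<close> is the obstruction.\<close>
  define z where "z = (\<lambda>xs\<in>tuples A 2. \<zero>\<^bsub>A\<^esub>)"
  interpret Z: product_family K A \<alpha> \<beta> "Suc n" "\<mu>s(Suc n := z)"
    by unfold_locales (use cochain in \<open>auto simp: le_Suc_eq z_def B.cochain_zero\<close>)
  have lower: "left_coeff A \<beta> (\<mu>s(Suc n := g)) s a b c = right_coeff A \<alpha> (\<mu>s(Suc n := g)) s a b c"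
    if "s \<le> n" "a \<in> carrier A" "b \<in> carrier A" "c \<in> carrier A" for g s a b c
    using that D.coeff_cong[of s "\<mu>s(Suc n := g)" a b c] by (simp add: assoc)
  have "Z.associator \<in> hoch_cocycles K A \<mu> \<alpha> \<beta> 3"
    by (rule Z.associator_cocycle) (simp_all add: lower mu0)
  then obtain f where f: "f \<in> hoch_cochains K A \<alpha> \<beta> 2"
    and df: "hoch_coboundary K A \<mu> \<alpha> \<beta> 2 f = Z.associator"
    using trivial_cohomology_3[OF alg assms(4)] by blast
  have top: "left_coeff A \<beta> (\<mu>s(Suc n := f)) (Suc n) a b c = right_coeff A \<alpha> (\<mu>s(Suc n := f)) (Suc n) a b c"
    if abc: "a \<in> carrier A" "b \<in> carrier A" "c \<in> carrier A" for a b c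
  proof -
    define L where "L = left_coeff A \<beta> (\<mu>s(Suc n := z)) (Suc n) a b c"
    define R where "R = right_coeff A \<alpha> (\<mu>s(Suc n := z)) (Suc n) a b c"
    define X where "X = f [\<mu> a b, \<beta> c] \<oplus>\<^bsub>A\<^esub> \<mu> (f [a, b]) (\<beta> c)"
    define Y where "Y = f [\<alpha> a, \<mu> b c] \<oplus>\<^bsub>A\<^esub> \<mu> (\<alpha> a) (f [b, c])"
    note closed = abc mu_closed alpha_closed beta_closed B.cochain2(1)[OF f]
    have LRXY: "L \<in> carrier A" "R \<in> carrier A" "Y \<in> carrier A" "X \<in> carrier A"
      unfolding L_def R_def X_def Y_def
      by (simp_all add: closed Z.left_coeff_closed Z.right_coeff_closed del: fun_upd_apply)
    have "L \<ominus>\<^bsub>A\<^esub> R = Y \<ominus>\<^bsub>A\<^esub> X"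
      using fun_cong[OF df, of "[a, b, c]"]
      by (simp add: Z.associator_apply B.coboundary_2[OF f] closed L_def R_def X_def Y_def M.a_comm)
    then have "L \<oplus>\<^bsub>A\<^esub> X = R \<oplus>\<^bsub>A\<^esub> Y"
      using LRXY by (rule M.minus_eq_minus_imp)
    then show ?thesis
      using B.coeff_update_top[OF cochain f abc]
      by (simp add: closed mu0 L_def R_def X_def Y_def z_def)
  qed
  have "is_deformation K A \<mu> \<alpha> \<beta> (Suc n) (\<mu>s(Suc n := f))"
    unfolding is_deformation_iff[OF alg]
  proof (intro conjI allI impI ballI)
    show "(\<mu>s(Suc n := f)) i \<in> hoch_cochains K A \<alpha> \<beta> 2" if "i \<le> Suc n" for i
      using that cochain f by (cases "i = Suc n") (simp_all add: le_Suc_eq)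
    show "(\<mu>s(Suc n := f)) 0 [a, b] = \<mu> a b" if "a \<in> carrier A" "b \<in> carrier A" for a b
      using that mu0 by simp
    show "left_coeff A \<beta> (\<mu>s(Suc n := f)) s a b c = right_coeff A \<alpha> (\<mu>s(Suc n := f)) s a b c"
      if "s \<le> Suc n" "a \<in> carrier A" "b \<in> carrier A" "c \<in> carrier A" for s a b c
      using that lower top by (cases "s = Suc n") simp_all
  qed
  with f show ?thesis
    by auto
qed

end
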